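(* Let $\mathbb{X}$ be a finite dimensional real inner product space, $f:\mathbb{X}\to\mathbb{R}$ be $L_f$-smooth, $g:\mathbb{X}\to(-\infty,\infty]$ be proper, lower semicontinuous and bounded below, and let $F:=f+g$ be coercive and bounded below. Let $\{x^k\}_{k\in\mathbb{N}}$ be the sequence generated by the PGenls algorithm (described in the context). If $F$ is a KL function of exponent $\theta\in[1/2,1)$, then there exist $\widehat{\varrho}\in(0,1)$ and $\gamma'>0$ such that for all sufficiently large $k$, with $\omega^*:=\lim_{k\to\infty}F(x^k)$ (this limit exists), $$F(x^k)-\omega^*\le\begin{cases}\gamma'\,\widehat{\varrho}^{\lceil\frac{k-1}{m+1}\rceil}&\text{if }\theta=1/2,\\ \gamma'\,k^{\frac{1-\theta}{1-2\theta}}&\text{if }\theta\in(1/2,1).\end{cases}$$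
   Context: $f$ is $L_f$-smooth: differentiable with $L_f$-Lipschitz gradient. $\partial$ is the limiting (Mordukhovich) subdifferential. For $\tau>0$, $\mathcal{P}_\tau g(x):=\arg\min_{z}\{\frac{1}{2\tau}\|z-x\|^2+g(z)\}$. For $\delta>0$ and $z=(x,u)\in\mathbb{X}\times\mathbb{X}$, $H_\delta(z):=F(x)+\frac{\delta}{2}\|x-u\|^2$. $\mathbb{X}\times\mathbb{X}$ carries the product Euclidean norm. $[t]_+:=\max(0,t)$. A proper lsc $h$ is a KL function of exponent $\theta\in[0,1)$ if for every $\overline{x}\in\mathrm{dom}\,\partial h$ there exist $c>0$, $\eta\in(0,\infty]$ and a neighborhood $\mathcal{U}$ of $\overline{x}$ such that, with $\varphi(t)=ct^{1-\theta}$, $\varphi'(h(x)-h(\overline{x}))\,\mathrm{dist}(0,\partial h(x))\ge1$ for all $x\in\mathcal{U}$ with $h(\overline{x})<h(x)<h(\overline{x})+\eta$. PGenls algorithm (nonmonotone line search proximal gradient with extrapolation). Parameters: $m\in\mathbb{N}$ (integer $\ge0$), $\delta\in(0,1/2)$, $0<\alpha<\delta/2$, $0<\tau_{\min}\le\frac{1}{2(\alpha+\delta)+L_f}<\tau_{\max}$, $\beta_{\max}\ge0$, $\eta_1,\eta_2\in(0,1)$. Start: $x^0\in\mathrm{dom}\,g$, $x^{-1}=x^0$, $z^0=(x^0,x^{-1})$. Iteration $k=0,1,2,\ldots$ (run indefinitely): choose any $\beta_{k,0}\in[0,\beta_{\max}]$ and $\tau_{k,0}\in[\tau_{\min},\tau_{\max}]$;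 for $l=0,1,2,\ldots$ set $\beta_k=\beta_{k,0}\eta_1^l$, $\tau_k=\max\{\tau_{k,0}\eta_2^l,\tau_{\min}\}$, $y^k=x^k+\beta_k(x^k-x^{k-1})$, pick $x^{k+1}\in\mathcal{P}_{\tau_k}g(y^k-\tau_k\nabla f(y^k))$, $z^{k+1}=(x^{k+1},x^k)$, and stop the inner loop (accepting $x^{k+1}$) as soon as $H_\delta(z^{k+1})\le\max_{j=[k-m]_+,\ldots,k}H_\delta(z^j)-\frac{\alpha}{2}\|z^{k+1}-z^k\|^2$. *)

theory Defs
  imports "HOL-Analysis.Analysis"
begin

definition proper_fun :: "('a \<Rightarrow> ereal) \<Rightarrow> bool" where
  "proper_fun h \<longleftrightarrow> (\<forall>x. h x \<noteq> -\<infinity>) \<and> (\<exists>x. h x \<noteq> \<infinity>)"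

definition dom_fun :: "('a \<Rightarrow> ereal) \<Rightarrow> 'a set" where
  "dom_fun h = {x. h x < \<infinity>}"

definition lsc_fun :: "('a::topological_space \<Rightarrow> ereal) \<Rightarrow> bool" where
  "lsc_fun h \<longleftrightarrow> (\<forall>x. h x \<le> Liminf (at x) h)"

definition bounded_below_fun :: "('a \<Rightarrow> ereal) \<Rightarrow> bool" where
  "bounded_below_fun h \<longleftrightarrow> (\<exists>b::real. \<forall>x. ereal b \<le> h x)"

definition coercive_fun :: "('a::real_normed_vector \<Rightarrow> ereal) \<Rightarrow> bool" where
  "coercive_fun h \<longleftrightarrow> (h \<longlongrightarrow> \<infinity>) at_infinity"

definition grad :: "('a::euclidean_space \<Rightarrow> real) \<Rightarrow> 'a \<Rightarrow> 'a" where
  "grad f x = (THE D. GDERIV f x :> D)"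

definition L_smooth :: "real \<Rightarrow> ('a::euclidean_space \<Rightarrow> real) \<Rightarrow> bool" where
  "L_smooth L f \<longleftrightarrow> (\<forall>x. f differentiable (at x)) \<and> L-lipschitz_on UNIV (grad f)"

text \<open>Regular (Frechet) subdifferential; empty where \<open>h\<close> is not finite.\<close>

definition frechet_subdiff :: "('a::euclidean_space \<Rightarrow> ereal) \<Rightarrow> 'a \<Rightarrow> 'a set" where
  "frechet_subdiff h x = {v. \<bar>h x\<bar> \<noteq> \<infinity> \<and>
     0 \<le> Liminf (at x) (\<lambda>y. (h y - h x - ereal (v \<bullet> (y - x))) / ereal (norm (y - x)))}"

definition limiting_subdiff :: "('a::euclidean_space \<Rightarrow> ereal) \<Rightarrow> 'a \<Rightarrow> 'a set" where
  "limiting_subdiff h x = {v. \<bar>h x\<bar> \<noteq> \<infinity> \<and>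
     (\<exists>xs vs. xs \<longlonglongrightarrow> x \<and> (\<lambda>n. h (xs n)) \<longlonglongrightarrow> h x \<and>
        (\<forall>n. vs n \<in> frechet_subdiff h (xs n)) \<and> vs \<longlonglongrightarrow> v)}"

text \<open>Extended-valued distance: \<open>edist_set 0 {} = \<infinity>\<close>, whereas \<^const>\<open>infdist\<close> would give 0,
  so the KL inequality is automatic at points with empty subdifferential.\<close>

definition edist_set :: "'a::metric_space \<Rightarrow> 'a set \<Rightarrow> ereal" where
  "edist_set x S = (INF v\<in>S. ereal (dist x v))"

definition KL_function :: "('a::euclidean_space \<Rightarrow> ereal) \<Rightarrow> real \<Rightarrow> bool" where
  "KL_function h \<theta> \<longleftrightarrow> proper_fun h \<and> lsc_fun h \<and> 0 \<le> \<theta> \<and> \<theta> < 1 \<and>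
     (\<forall>xb. limiting_subdiff h xb \<noteq> {} \<longrightarrow>
       (\<exists>(c::real) (\<eta>::ereal) U. 0 < c \<and> 0 < \<eta> \<and> open U \<and> xb \<in> U \<and>
         (\<forall>x\<in>U. h xb < h x \<and> h x < h xb + \<eta> \<longrightarrow>
            1 \<le> ereal (deriv (\<lambda>t. c * t powr (1 - \<theta>)) (real_of_ereal (h x - h xb)))
                 * edist_set 0 (limiting_subdiff h x))))"

definition prox :: "real \<Rightarrow> ('a::real_inner \<Rightarrow> ereal) \<Rightarrow> 'a \<Rightarrow> 'a set" where
  "prox \<tau> g x = {p. is_arg_min (\<lambda>z. ereal (1 / (2 * \<tau>) * (norm (z - x))\<^sup>2) + g z) (\<lambda>_. True) p}"

definition composite :: "('a \<Rightarrow> real) \<Rightarrow> ('a \<Rightarrow> ereal) \<Rightarrow> 'a \<Rightarrow> ereal" where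
  "composite f g x = ereal (f x) + g x"

definition H_fun :: "('a::real_normed_vector \<Rightarrow> ereal) \<Rightarrow> real \<Rightarrow> 'a \<times> 'a \<Rightarrow> ereal" where
  "H_fun F \<delta> z = F (fst z) + ereal (\<delta> / 2 * (norm (fst z - snd z))\<^sup>2)"

text \<open>\<open>z_iter x k\<close> is the pair \<open>(x k, x (k - 1))\<close>; truncated subtraction on \<^typ>\<open>nat\<close> encodes
  the convention \<open>x (-1) = x 0\<close>. The norm on pairs is the product Euclidean norm.\<close>

definition z_iter :: "(nat \<Rightarrow> 'a) \<Rightarrow> nat \<Rightarrow> 'a \<times> 'a" where
  "z_iter x k = (x k, x (k - 1))"

definition PGenls_accept ::
  "('a::euclidean_space \<Rightarrow> ereal) \<Rightarrow> nat \<Rightarrow> real \<Rightarrow> real \<Rightarrow> (nat \<Rightarrow> 'a) \<Rightarrow> nat \<Rightarrow> 'a \<Rightarrow> bool" where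
  "PGenls_accept F m \<delta> \<alpha> x k p \<longleftrightarrow>
     H_fun F \<delta> (p, x k) \<le>
       Max ((\<lambda>j. H_fun F \<delta> (z_iter x j)) ` {k - m..k})
       - ereal (\<alpha> / 2 * (norm ((p, x k) - z_iter x k))\<^sup>2)"

text \<open>The point \<open>p l\<close> is the one picked in pass \<open>l\<close> of the inner loop of
  iteration \<open>k\<close>; the loop stops at the first pass \<open>N\<close> whose point is accepted.\<close>

definition PGenls_step ::
  "('a::euclidean_space \<Rightarrow> real) \<Rightarrow> ('a \<Rightarrow> ereal) \<Rightarrow> nat \<Rightarrow> real \<Rightarrow> real \<Rightarrow> real \<Rightarrow> real \<Rightarrow> real
     \<Rightarrow> real \<Rightarrow> real \<Rightarrow> (nat \<Rightarrow> 'a) \<Rightarrow> nat \<Rightarrow> bool" where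
  "PGenls_step f g m \<delta> \<alpha> \<tau>min \<tau>max \<beta>max \<eta>1 \<eta>2 x k \<longleftrightarrow>
     (\<exists>\<beta>0\<in>{0..\<beta>max}. \<exists>\<tau>0\<in>{\<tau>min..\<tau>max}. \<exists>(p :: nat \<Rightarrow> 'a) N.
        (\<forall>l\<le>N. let \<beta> = \<beta>0 * \<eta>1 ^ l;
                    \<tau> = max (\<tau>0 * \<eta>2 ^ l) \<tau>min;
                    y = x k + \<beta> *\<^sub>R (x k - x (k - 1))
                in p l \<in> prox \<tau> g (y - \<tau> *\<^sub>R grad f y)) \<and>
        (\<forall>l<N. \<not> PGenls_accept (composite f g) m \<delta> \<alpha> x k (p l)) \<and>
        PGenls_accept (composite f g) m \<delta> \<alpha> x k (p N) \<and>
        x (Suc k) = p N)"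

definition PGenls_sequence ::
  "('a::euclidean_space \<Rightarrow> real) \<Rightarrow> ('a \<Rightarrow> ereal) \<Rightarrow> nat \<Rightarrow> real \<Rightarrow> real \<Rightarrow> real \<Rightarrow> real \<Rightarrow> real
     \<Rightarrow> real \<Rightarrow> real \<Rightarrow> (nat \<Rightarrow> 'a) \<Rightarrow> bool" where
  "PGenls_sequence f g m \<delta> \<alpha> \<tau>min \<tau>max \<beta>max \<eta>1 \<eta>2 x \<longleftrightarrow>
     x 0 \<in> dom_fun g \<and> (\<forall>k. PGenls_step f g m \<delta> \<alpha> \<tau>min \<tau>max \<beta>max \<eta>1 \<eta>2 x k)"

end

(* Let M k be the maximum of H_delta over the last m + 1 iterates. The line search makes M
   nonincreasing, and comparing the prox point with the previous iterate bounds the increase of F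
   in one step by a multiple of the squared steps. Together these control M k - H_delta(z_k) by
   M k - M (k + m + 1), so F(x_k) converges to omega = lim M and the steps vanish. Cluster points
   are critical with value omega, hence the KL inequality of F itself (no KL property of H_delta is
   needed) holds with uniform constants along the iterates. At the index attaining M (k + m + 1) it
   gives, for Phi = M - omega,
     Phi (k + m + 1) + c * Phi (k + m + 1) powr (2 theta) <= Phi k,
   and this recursion yields both rates. For theta > 1/2 it even gives k powr (1 / (1 - 2 theta)). *)
theory Submission
  imports Defs
begin

subsection \<open>Smooth functions and proximal gradient steps\<close>

text \<open>The function \<open>g\<close> is only lower semicontinuous, so small steps alone do not
  force small changes of \<open>F\<close>, and an iterate could lie far below the running maximum.
  What excludes this is that the increase \<open>C * e k\<close> and the guaranteed decrease
  \<open>a * e k\<close> are both multiples of the same \<open>e k\<close>. Hence a gap below the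
  maximum shrinks at most by the factor \<open>1 + C / a\<close> per step, and within
  \<open>m + 1\<close> steps an index is reached whose value is a later maximum.

  The exponent \<open>2 * \<theta>\<close> arises because the line search pays in squared steps,
  while a prox step yields a subgradient whose norm is linear in the steps; the KL inequality
  therefore has to be squared. The condition \<open>\<theta> \<ge> 1/2\<close> makes this exponent
  at least 1, so the quadratic penalty in \<open>H_fun\<close> is absorbed as soon as
  \<open>e k < 1\<close>. The stride \<open>m + 1\<close> is the shortest shift after which the
  window contains only indices larger than \<open>k\<close>, so that its maximum was produced by a
  step taken at or after \<open>k\<close>.\<close>

text \<open>\<open>grad\<close> is a definite description. Existence comes from the coordinates of
  the derivative in \<open>Basis\<close>, uniqueness from uniqueness of the Frechet
  derivative.\<close>

lemma GDERIV_grad: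
  fixes f :: "'a::euclidean_space \<Rightarrow> real"
  assumes "f differentiable (at x)"
  shows "GDERIV f x :> grad f x"
proof -
  obtain A where A: "(f has_derivative A) (at x)"
    using assms unfolding differentiable_def by blast
  interpret A: bounded_linear A using A by (rule has_derivative_bounded_linear)
  have "A h = h \<bullet> (\<Sum>b\<in>Basis. A b *\<^sub>R b)" for h
  proof -
    have "A h = A (\<Sum>b\<in>Basis. (h \<bullet> b) *\<^sub>R b)" by (simp add: euclidean_representation)
    also have "\<dots> = (\<Sum>b\<in>Basis. (h \<bullet> b) * A b)" by (simp add: A.sum A.scaleR)
    finally show ?thesis by (simp add: inner_sum_right mult.commute)
  qed
  then have "A = (\<lambda>h. h \<bullet> (\<Sum>b\<in>Basis. A b *\<^sub>R b))" by (rule ext)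
  with A have ex: "GDERIV f x :> (\<Sum>b\<in>Basis. A b *\<^sub>R b)"
    unfolding gderiv_def by (rule back_subst)
  have "grad f x = (\<Sum>b\<in>Basis. A b *\<^sub>R b)"
    unfolding grad_def
  proof (rule the_equality)
    fix D assume "GDERIV f x :> D"
    then have "(\<lambda>h. h \<bullet> D) = (\<lambda>h. h \<bullet> (\<Sum>b\<in>Basis. A b *\<^sub>R b))"
      using ex unfolding gderiv_def by (rule has_derivative_unique)
    then have "\<forall>h. h \<bullet> D = h \<bullet> (\<Sum>b\<in>Basis. A b *\<^sub>R b)"
      by (blast dest: fun_cong)
    then show "D = (\<Sum>b\<in>Basis. A b *\<^sub>R b)"
      by (simp only: vector_eq_ldot)
  qed (rule ex)
  with ex show ?thesis by simp
qed

lemma L_smooth_GDERIV: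
  "L_smooth L f \<Longrightarrow> GDERIV f x :> grad f x"
  by (simp add: L_smooth_def GDERIV_grad)

lemma L_smooth_norm_grad_diff:
  "L_smooth L f \<Longrightarrow> norm (grad f u - grad f y) \<le> L * norm (u - y)"
  by (auto simp: L_smooth_def dist_norm dest: lipschitz_onD)

lemma L_smooth_nonneg: "L_smooth L f \<Longrightarrow> 0 \<le> L"
  by (auto simp: L_smooth_def dest: lipschitz_on_nonneg)

text \<open>The mean value inequality is applied to \<open>f\<close> minus the linear map given by
  \<open>grad f y\<close>. The slope is taken at a third point \<open>y\<close> because the
  algorithm evaluates the gradient at the extrapolated point, not at either endpoint.\<close>

lemma L_smooth_linearization:
  fixes f :: "'a::euclidean_space \<Rightarrow> real"
  assumes f: "L_smooth L f"
  shows "\<bar>f p - f z - grad f y \<bullet> (p - z)\<bar> \<le> L * (norm (p - y) + norm (z - y)) * norm (p - z)"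
proof -
  define B where "B = L * (norm (p - y) + norm (z - y))"
  have L: "0 \<le> L" using f by (rule L_smooth_nonneg)
  have "norm ((f p - grad f y \<bullet> p) - (f z - grad f y \<bullet> z)) \<le> B * norm (p - z)"
  proof (rule differentiable_bound[where S = "closed_segment z p"])
    fix u assume u: "u \<in> closed_segment z p"
    show "((\<lambda>u. f u - grad f y \<bullet> u) has_derivative (\<lambda>h. h \<bullet> grad f u - grad f y \<bullet> h))
        (at u within closed_segment z p)"
      using L_smooth_GDERIV[OF f, of u] unfolding gderiv_def
      by (intro has_derivative_diff bounded_linear_imp_has_derivative bounded_linear_inner_right)
        (rule has_derivative_at_withinI)
    obtain t where t: "0 \<le> t" "t \<le> 1" "u = (1 - t) *\<^sub>R z + t *\<^sub>R p"
      using u unfolding in_segment by blast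
    have "u - y = (1 - t) *\<^sub>R (z - y) + t *\<^sub>R (p - y)"
      unfolding t(3) by (simp add: algebra_simps)
    then have "norm (u - y) \<le> (1 - t) * norm (z - y) + t * norm (p - y)"
      using t norm_triangle_ineq[of "(1 - t) *\<^sub>R (z - y)" "t *\<^sub>R (p - y)"] by simp
    also have "\<dots> \<le> norm (p - y) + norm (z - y)"
      using t mult_left_le_one_le[of "norm (z - y)" "1 - t"]
        mult_left_le_one_le[of "norm (p - y)" t] by simp
    finally have "L * norm (u - y) \<le> B"
      unfolding B_def using L by (rule mult_left_mono)
    with L_smooth_norm_grad_diff[OF f, of u y] have B: "norm (grad f u - grad f y) \<le> B"
      by (rule order_trans)
    have "norm (h \<bullet> grad f u - grad f y \<bullet> h) \<le> B * norm h" for h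
    proof -
      have "h \<bullet> grad f u - grad f y \<bullet> h = (grad f u - grad f y) \<bullet> h"
        by (simp add: inner_diff_right inner_commute)
      moreover have "\<bar>(grad f u - grad f y) \<bullet> h\<bar> \<le> norm (grad f u - grad f y) * norm h"
        by (rule Cauchy_Schwarz_ineq2)
      moreover have "\<dots> \<le> B * norm h" using B by (rule mult_right_mono) simp
      ultimately show ?thesis by simp
    qed
    then show "onorm (\<lambda>h. h \<bullet> grad f u - grad f y \<bullet> h) \<le> B"
      by (rule onorm_le)
  qed auto
  then show ?thesis unfolding B_def by (simp add: inner_diff_right algebra_simps)
qed

lemma proper_funD: "proper_fun h \<Longrightarrow> h x \<noteq> -\<infinity>"
  by (simp add: proper_fun_def)

lemma proper_fun_ex_finite: "proper_fun h \<Longrightarrow> \<exists>z r. h z = ereal r"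
  unfolding proper_fun_def by (metis real_of_ereal.cases)

lemma prox_le:
  assumes "p \<in> prox \<tau> g w"
  shows "ereal (1 / (2 * \<tau>) * (norm (p - w))\<^sup>2) + g p \<le> ereal (1 / (2 * \<tau>) * (norm (z - w))\<^sup>2) + g z"
  using assms by (auto simp: prox_def is_arg_min_def not_less)

lemma prox_finite:
  assumes "p \<in> prox \<tau> g w" "proper_fun g"
  shows "g p \<noteq> \<infinity>"
proof -
  obtain z r where "g z = ereal r" using proper_fun_ex_finite[OF assms(2)] by blast
  then show ?thesis using prox_le[OF assms(1), of z] by auto
qed

text \<open>Completing the square in the prox objective: the term
  \<open>\<tau> / 2 * (norm G)\<^sup>2\<close> does not depend on the competitor and
  cancels.\<close>

lemma prox_gradient_step_le:
  fixes g :: "'a::euclidean_space \<Rightarrow> ereal"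
  assumes p: "p \<in> prox \<tau> g (y - \<tau> *\<^sub>R G)" and g: "proper_fun g" and \<tau>: "0 < \<tau>"
  shows "g p \<le> g z + ereal (((norm (z - y))\<^sup>2 - (norm (p - y))\<^sup>2) / (2 * \<tau>) + G \<bullet> (z - p))"
proof (cases "g z")
  case (real b)
  obtain a where a: "g p = ereal a"
    using prox_finite[OF p g] proper_funD[OF g] by (cases "g p") auto
  have expand: "1 / (2 * \<tau>) * (norm (u - (y - \<tau> *\<^sub>R G)))\<^sup>2
      = (norm (u - y))\<^sup>2 / (2 * \<tau>) + G \<bullet> (u - y) + \<tau> / 2 * (norm G)\<^sup>2" for u
  proof -
    have "(norm (u - (y - \<tau> *\<^sub>R G)))\<^sup>2 = (norm (u - y))\<^sup>2 + 2 * \<tau> * (G \<bullet> (u - y)) + \<tau>\<^sup>2 * (norm G)\<^sup>2"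
      unfolding power2_norm_eq_inner
      by (simp add: algebra_simps inner_commute power2_eq_square)
    then show ?thesis using \<tau> by (simp add: field_simps power2_eq_square)
  qed
  show ?thesis
    using prox_le[OF p, of z] unfolding expand real a
    by (simp add: inner_diff_right diff_divide_distrib)
qed (use proper_funD[OF g] in auto)

text \<open>The competitor \<open>z\<close> is arbitrary, and this estimate compares values without
  any continuity of \<open>g\<close>. It serves with \<open>z\<close> the current iterate, to bound
  the increase in one step, and with \<open>z\<close> a cluster point, to identify the limit
  value.\<close>

lemma composite_prox_gradient_le:
  fixes f :: "'a::euclidean_space \<Rightarrow> real"
  assumes f: "L_smooth L f" and g: "proper_fun g" and \<tau>: "0 < \<tau>"
    and p: "p \<in> prox \<tau> g (y - \<tau> *\<^sub>R grad f y)"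
  shows "composite f g p \<le> composite f g z
    + ereal (L * (norm (p - y) + norm (z - y)) * norm (p - z) + (norm (z - y))\<^sup>2 / (2 * \<tau>))"
proof -
  have "composite f g p \<le> ereal (f p) + (g z
      + ereal (((norm (z - y))\<^sup>2 - (norm (p - y))\<^sup>2) / (2 * \<tau>) + grad f y \<bullet> (z - p)))"
    unfolding composite_def by (intro add_left_mono prox_gradient_step_le[OF p g \<tau>])
  also have "\<dots> = g z + ereal (f p + ((norm (z - y))\<^sup>2 - (norm (p - y))\<^sup>2) / (2 * \<tau>) + grad f y \<bullet> (z - p))"
    by (cases "g z") auto
  also have "\<dots> \<le> g z + ereal (f z
      + (L * (norm (p - y) + norm (z - y)) * norm (p - z) + (norm (z - y))\<^sup>2 / (2 * \<tau>)))"
  proof -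
    have "((norm (z - y))\<^sup>2 - (norm (p - y))\<^sup>2) / (2 * \<tau>) \<le> (norm (z - y))\<^sup>2 / (2 * \<tau>)"
      using \<tau> by (simp add: divide_right_mono)
    moreover have "grad f y \<bullet> (z - p) = - (grad f y \<bullet> (p - z))" by (simp add: inner_diff_right)
    ultimately show ?thesis
      using L_smooth_linearization[OF f, of p z y] by (intro add_left_mono) auto
  qed
  also have "\<dots> = composite f g z
      + ereal (L * (norm (p - y) + norm (z - y)) * norm (p - z) + (norm (z - y))\<^sup>2 / (2 * \<tau>))"
    unfolding composite_def by (cases "g z") auto
  finally show ?thesis .
qed

text \<open>Minimality of the prox point supplies a quadratic minorant of \<open>g\<close> that
  touches it at \<open>p\<close>. Together with the first-order expansion of \<open>f\<close> it
  bounds the difference quotient directly, so no sum rule for subdifferentials enters.\<close>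

lemma prox_gradient_frechet_subdiff:
  fixes f :: "'a::euclidean_space \<Rightarrow> real"
  assumes f: "L_smooth L f" and g: "proper_fun g" and \<tau>: "0 < \<tau>"
    and p: "p \<in> prox \<tau> g (y - \<tau> *\<^sub>R grad f y)"
  shows "grad f p - grad f y - (1 / \<tau>) *\<^sub>R (p - y) \<in> frechet_subdiff (composite f g) p"
proof -
  define v where "v = grad f p - grad f y - (1 / \<tau>) *\<^sub>R (p - y)"
  \<comment> \<open>A real lower bound of the difference quotient: the first-order remainder of
    \<open>f\<close> minus the curvature term of the prox objective, both of which vanish at
    \<open>p\<close>.\<close>
  define \<psi> where "\<psi> z = (f z - f p - (z - p) \<bullet> grad f p) / norm (z - p) - norm (z - p) / (2 * \<tau>)" for z
  obtain a where a: "g p = ereal a"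
    using prox_finite[OF p g] proper_funD[OF g] by (cases "g p") auto
  have quotient_ge: "ereal (\<psi> z) \<le> (composite f g z - composite f g p - ereal (v \<bullet> (z - p))) / ereal (norm (z - p))"
    if "z \<noteq> p" for z
  proof (cases "g z")
    case (real b)
    have "a \<le> b + (((norm (z - y))\<^sup>2 - (norm (p - y))\<^sup>2) / (2 * \<tau>) + grad f y \<bullet> (z - p))"
      using prox_gradient_step_le[OF p g \<tau>, of z] by (simp add: a real)
    moreover have "((norm (z - y))\<^sup>2 - (norm (p - y))\<^sup>2) / (2 * \<tau>)
        = (norm (z - p))\<^sup>2 / (2 * \<tau>) + (1 / \<tau>) * ((p - y) \<bullet> (z - p))"
    proof -
      have "(norm (z - y))\<^sup>2 - (norm (p - y))\<^sup>2 = (norm (z - p))\<^sup>2 + 2 * ((p - y) \<bullet> (z - p))"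
        unfolding power2_norm_eq_inner by (simp add: algebra_simps inner_commute)
      then show ?thesis by (simp add: add_divide_distrib)
    qed
    moreover have "v \<bullet> (z - p) = (z - p) \<bullet> grad f p - grad f y \<bullet> (z - p) - (1 / \<tau>) * ((p - y) \<bullet> (z - p))"
      unfolding v_def by (simp only: inner_diff_left inner_scaleR_left) (simp add: inner_commute inner_diff_left inner_diff_right algebra_simps)
    ultimately have "f z - f p - (z - p) \<bullet> grad f p - (norm (z - p))\<^sup>2 / (2 * \<tau>)
        \<le> f z + b - (f p + a) - v \<bullet> (z - p)"
      by linarith
    then have "(f z - f p - (z - p) \<bullet> grad f p - (norm (z - p))\<^sup>2 / (2 * \<tau>)) / norm (z - p)
        \<le> (f z + b - (f p + a) - v \<bullet> (z - p)) / norm (z - p)"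
      by (rule divide_right_mono) simp
    moreover have "\<psi> z = (f z - f p - (z - p) \<bullet> grad f p - (norm (z - p))\<^sup>2 / (2 * \<tau>)) / norm (z - p)"
      unfolding \<psi>_def using that by (simp add: diff_divide_distrib power2_eq_square)
    ultimately show ?thesis using that by (simp add: composite_def a real)
  next
    case PInf
    then show ?thesis using that by (simp add: composite_def a)
  qed (use proper_funD[OF g] in auto)
  have "((\<lambda>z. (f z - f p - (z - p) \<bullet> grad f p) / norm (z - p)) \<longlongrightarrow> 0) (at p)"
    using L_smooth_GDERIV[OF f, of p] unfolding gderiv_def has_derivative_iff_norm
    by (subst tendsto_rabs_zero_iff[symmetric]) simp
  moreover have "((\<lambda>z. norm (z - p) / (2 * \<tau>)) \<longlongrightarrow> 0) (at p)"
    using \<tau> by (auto intro!: tendsto_eq_intros)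
  ultimately have "((\<lambda>z. ereal (\<psi> z)) \<longlongrightarrow> ereal (0 - 0)) (at p)"
    unfolding \<psi>_def by (intro tendsto_ereal tendsto_diff)
  then have "0 = Liminf (at p) (\<lambda>z. ereal (\<psi> z))"
    using lim_imp_Liminf[of "at p" "\<lambda>z. ereal (\<psi> z)" "ereal (0 - 0)"]
    by (simp add: zero_ereal_def)
  also have "\<dots> \<le> Liminf (at p) (\<lambda>z. (composite f g z - composite f g p - ereal (v \<bullet> (z - p))) / ereal (norm (z - p)))"
    by (rule Liminf_mono) (use quotient_ge in \<open>auto simp: eventually_at_filter\<close>)
  finally show ?thesis
    unfolding frechet_subdiff_def v_def by (simp add: composite_def a)
qed

lemma frechet_subset_limiting_subdiff: "frechet_subdiff h x \<subseteq> limiting_subdiff h x"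
proof
  fix v assume v: "v \<in> frechet_subdiff h x"
  then have "\<bar>h x\<bar> \<noteq> \<infinity>" by (simp add: frechet_subdiff_def)
  moreover have "(\<lambda>_::nat. x) \<longlonglongrightarrow> x \<and> (\<lambda>_::nat. h x) \<longlonglongrightarrow> h x \<and>
      (\<forall>n::nat. v \<in> frechet_subdiff h x) \<and> (\<lambda>_::nat. v) \<longlonglongrightarrow> v"
    using v by simp
  ultimately show "v \<in> limiting_subdiff h x"
    unfolding limiting_subdiff_def
    by (intro CollectI conjI exI[of _ "\<lambda>_. x"] exI[of _ "\<lambda>_. v"]) blast+
qed

subsection \<open>Nonmonotone descent of real sequences\<close>

lemma nonmonotone_max_antimono:
  fixes h e :: "nat \<Rightarrow> real" and m :: nat
  assumes e: "\<And>k. 0 \<le> e k"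
    and descent: "\<And>k. h (Suc k) \<le> Max (h ` {k - m..k}) - e k"
  shows "antimono (\<lambda>k. Max (h ` {k - m..k}))"
proof (rule decseq_SucI)
  fix k
  show "Max (h ` {Suc k - m..Suc k}) \<le> Max (h ` {k - m..k})"
  proof (rule Max.boundedI)
    fix a assume "a \<in> h ` {Suc k - m..Suc k}"
    then obtain j where j: "a = h j" "Suc k - m \<le> j" "j \<le> Suc k" by auto
    show "a \<le> Max (h ` {k - m..k})"
    proof (cases "j = Suc k")
      case True
      then show ?thesis using descent[of k] e[of k] j by simp
    next
      case False
      then show ?thesis using j by (auto intro!: Max_ge)
    qed
  qed auto
qed

text \<open>The window at \<open>Suc (k + m)\<close> starts at \<open>Suc k\<close>, so every index
  in it is a successor \<open>Suc i\<close> with \<open>k \<le> i\<close>, and the descent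
  inequality of step \<open>i\<close> applies to the maximizer.\<close>

lemma nonmonotone_max_attained:
  fixes h :: "nat \<Rightarrow> real"
  obtains i where "k \<le> i" "i \<le> k + m" "Max (h ` {Suc (k + m) - m..Suc (k + m)}) = h (Suc i)"
proof -
  have "Max (h ` {Suc (k + m) - m..Suc (k + m)}) \<in> h ` {Suc (k + m) - m..Suc (k + m)}"
    by (rule Max_in) auto
  then obtain j where j: "Max (h ` {Suc (k + m) - m..Suc (k + m)}) = h j" "j \<in> {Suc (k + m) - m..Suc (k + m)}"
    by (elim imageE)
  then show thesis by (intro that[of "j - 1"]) auto
qed

text \<open>The gap between the running maximum and the current value can grow by at most a fixed factor
  per backward step, and it vanishes where the maximum is attained.\<close>

lemma nonmonotone_descent_gap:
  fixes h e :: "nat \<Rightarrow> real" and m :: nat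
  defines "M \<equiv> \<lambda>k. Max (h ` {k - m..k})"
  assumes a: "0 < a" and C: "0 \<le> C" and e: "\<And>k. 0 \<le> e k"
    and descent: "\<And>k. h (Suc k) \<le> M k - a * e k"
    and backward: "\<And>k. h (Suc k) \<le> h k + C * e k"
  shows "M k - h k \<le> 2 * (1 + C / a) ^ Suc m * (M k - M (k + Suc m))"
proof -
  define \<kappa> where "\<kappa> = 1 + C / a"
  have \<kappa>: "1 \<le> \<kappa>" unfolding \<kappa>_def using a C by simp
  have anti: "M j \<le> M i" if "i \<le> j" for i j
    using nonmonotone_max_antimono[of "\<lambda>k. a * e k" h m] a e descent that
    unfolding M_def by (simp add: antimono_def)
  \<comment> \<open>The descent inequality bounds \<open>e i\<close> by
    \<open>(M i - h (Suc i)) / a\<close>. Inserting this into the one-step growth bound is the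
    origin of \<kappa>.\<close>
  have one: "M i - h i \<le> \<kappa> * (M i - h (Suc i))" for i
  proof -
    have "C * e i = (C / a) * (a * e i)" using a by simp
    also have "\<dots> \<le> (C / a) * (M i - h (Suc i))"
      using descent[of i] a C by (intro mult_left_mono) auto
    finally show ?thesis using backward[of i] by (simp add: \<kappa>_def algebra_simps)
  qed
  have gap: "0 \<le> M i - h i" for i
    unfolding M_def by (simp add: Max_ge)
  have iter: "M i - h i \<le> \<kappa> ^ n * (M (i + n) - h (i + n)) + \<kappa> ^ n * (M i - M (i + n))" for i n
  proof (induction n)
    case (Suc n)
    have "M (i + n) - h (i + n) + (M i - M (i + n)) \<le> \<kappa> * (M (i + n) - h (i + Suc n)) + \<kappa> * (M i - M (i + n))"
      using one[of "i + n"] mult_right_mono[OF \<kappa>, of "M i - M (i + n)"] anti[of i "i + n"] by simp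
    also have "\<dots> = \<kappa> * (M (i + Suc n) - h (i + Suc n)) + \<kappa> * (M i - M (i + Suc n))"
      by (simp add: algebra_simps)
    finally have "\<kappa> ^ n * (M (i + n) - h (i + n) + (M i - M (i + n)))
        \<le> \<kappa> ^ n * (\<kappa> * (M (i + Suc n) - h (i + Suc n)) + \<kappa> * (M i - M (i + Suc n)))"
      using \<kappa> by (intro mult_left_mono) auto
    then show ?case using Suc by (simp add: algebra_simps)
  qed simp
  obtain i where i: "k \<le> i" "i \<le> k + m" "M (Suc (k + m)) = h (Suc i)"
    using nonmonotone_max_attained unfolding M_def by blast
  define n where "n = Suc i - k"
  have n: "k + n = Suc i" "n \<le> Suc m" using i by (auto simp: n_def)
  have "M k - h k \<le> \<kappa> ^ n * ((M (Suc i) - h (Suc i)) + (M k - M (Suc i)))"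
    using iter[of k n] unfolding n(1) distrib_left .
  \<comment> \<open>Since \<open>h (Suc i)\<close> equals \<open>M (k + Suc m)\<close>, both
    summands are differences of values of \<open>M\<close> between \<open>k\<close> and
    \<open>k + Suc m\<close>; this gives the factor 2.\<close>
  also have "\<dots> \<le> \<kappa> ^ n * (2 * (M k - M (k + Suc m)))"
    using \<kappa> i anti[of k "Suc i"] anti[of "Suc i" "k + Suc m"] by (intro mult_left_mono) auto
  also have "\<dots> \<le> \<kappa> ^ Suc m * (2 * (M k - M (k + Suc m)))"
    using \<kappa> n anti[of k "k + Suc m"] by (intro mult_right_mono power_increasing) auto
  finally show ?thesis unfolding \<kappa>_def by (simp only: mult_ac)
qed

text \<open>\<open>M\<close> converges by monotonicity and the lower bound. The gap estimate
  squeezes \<open>M - h\<close> by a telescoping difference that vanishes, and then the descent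
  inequality forces \<open>e\<close> to zero.\<close>

lemma nonmonotone_descent_convergence:
  fixes h e :: "nat \<Rightarrow> real" and m :: nat
  defines "M \<equiv> \<lambda>k. Max (h ` {k - m..k})"
  assumes a: "0 < a" and C: "0 \<le> C" and e: "\<And>k. 0 \<le> e k"
    and descent: "\<And>k. h (Suc k) \<le> M k - a * e k"
    and backward: "\<And>k. h (Suc k) \<le> h k + C * e k"
    and lower: "\<And>k. b \<le> h k"
  obtains \<omega> where "M \<longlonglongrightarrow> \<omega>" "h \<longlonglongrightarrow> \<omega>" "e \<longlonglongrightarrow> 0" "\<And>k. \<omega> \<le> M k"
proof -
  have anti: "antimono M"
    using nonmonotone_max_antimono[of "\<lambda>k. a * e k" h m] a e descent unfolding M_def by simp
  have gap: "h i \<le> M i" for i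
    unfolding M_def by (simp add: Max_ge)
  then have bM: "b \<le> M k" for k using lower[of k] order_trans by blast
  obtain \<omega> where \<omega>: "M \<longlonglongrightarrow> \<omega>" "\<And>k. \<omega> \<le> M k"
    using decseq_convergent[OF anti, of b] bM by blast
  have "(\<lambda>k. 2 * (1 + C / a) ^ Suc m * (M k - M (k + Suc m))) \<longlonglongrightarrow> 2 * (1 + C / a) ^ Suc m * (\<omega> - \<omega>)"
    by (intro tendsto_intros \<omega> LIMSEQ_ignore_initial_segment)
  then have lim: "(\<lambda>k. 2 * (1 + C / a) ^ Suc m * (M k - M (k + Suc m))) \<longlonglongrightarrow> 0"
    by simp
  have "(\<lambda>k. M k - h k) \<longlonglongrightarrow> 0"
  proof (rule real_tendsto_sandwich[OF _ _ tendsto_const lim])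
    show "\<forall>\<^sub>F k in sequentially. 0 \<le> M k - h k"
      using gap by simp
    show "\<forall>\<^sub>F k in sequentially. M k - h k \<le> 2 * (1 + C / a) ^ Suc m * (M k - M (k + Suc m))"
      using nonmonotone_descent_gap[OF a C e descent[unfolded M_def] backward]
      unfolding M_def by (intro always_eventually allI)
  qed
  from tendsto_diff[OF \<omega>(1) this] have h: "h \<longlonglongrightarrow> \<omega>" by simp
  have "(\<lambda>k. (M k - h (Suc k)) / a) \<longlonglongrightarrow> (\<omega> - \<omega>) / a"
    using a by (intro tendsto_intros \<omega> LIMSEQ_Suc h) auto
  moreover have "e k \<le> (M k - h (Suc k)) / a" for k
    using descent[of k] a by (simp add: field_simps)
  ultimately have "e \<longlonglongrightarrow> 0"
    using e by (intro real_tendsto_sandwich[of "\<lambda>_. 0" e sequentially "\<lambda>k. (M k - h (Suc k)) / a" 0]) auto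
  with \<omega> h show thesis by (intro that)
qed

lemma nonmonotone_block_decrease:
  fixes h e :: "nat \<Rightarrow> real" and m :: nat
  defines "M \<equiv> \<lambda>k. Max (h ` {k - m..k})"
  assumes a: "0 < a" and e: "\<And>k. 0 \<le> e k"
    and descent: "\<And>k. h (Suc k) \<le> M k - a * e k"
    and lower: "\<And>k. \<omega> \<le> M k" and B: "0 < B"
    and error: "\<forall>\<^sub>F k in sequentially. \<omega> < h (Suc k) \<longrightarrow> (h (Suc k) - \<omega>) powr q \<le> B * e k"
  shows "\<exists>K. \<forall>k\<ge>K. M (k + Suc m) - \<omega> + a / B * (M (k + Suc m) - \<omega>) powr q \<le> M k - \<omega>"
proof -
  have anti: "antimono M"
    using nonmonotone_max_antimono[of "\<lambda>k. a * e k" h m] a e descent unfolding M_def by simp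
  obtain K where K: "\<And>k. K \<le> k \<Longrightarrow> \<omega> < h (Suc k) \<Longrightarrow> (h (Suc k) - \<omega>) powr q \<le> B * e k"
    using error unfolding eventually_sequentially by blast
  have "M (k + Suc m) - \<omega> + a / B * (M (k + Suc m) - \<omega>) powr q \<le> M k - \<omega>" if k: "K \<le> k" for k
  proof (cases "\<omega> < M (k + Suc m)")
    case True
    obtain i where i: "k \<le> i" "M (Suc (k + m)) = h (Suc i)"
      using nonmonotone_max_attained unfolding M_def by blast
    \<comment> \<open>The error bound is used at the step \<open>i\<close> that produced the maximum
      of the later window; the decrease there is measured from \<open>M i\<close>, which is at most
      \<open>M k\<close>.\<close>
    have "a / B * (h (Suc i) - \<omega>) powr q \<le> a / B * (B * e i)"
      using K[of i] i k True a B by (intro mult_left_mono) auto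
    also have "\<dots> = a * e i" using B by simp
    also have "\<dots> \<le> M k - h (Suc i)"
      using descent[of i] antimonoD[OF anti i(1)] by linarith
    finally show ?thesis using i by simp
  \<comment> \<open>Here \<open>M (k + Suc m) = \<omega>\<close>, and the power term is
    \<open>0 powr q\<close>, which is 0.\<close>
  next
    case False
    then show ?thesis using lower[of "k + Suc m"] lower[of k] by simp
  qed
  then show ?thesis by blast
qed

section \<open>Decay rates of sequences that satisfy a block recursion\<close>

lemma linear_rate_of_block_decrease:
  fixes \<Phi> :: "nat \<Rightarrow> real"
  assumes c: "0 < c" and nonneg: "\<And>k. 0 \<le> \<Phi> k" and anti: "antimono \<Phi>"
    and dec: "\<And>k. K \<le> k \<Longrightarrow> \<Phi> (k + Suc m) + c * \<Phi> (k + Suc m) \<le> \<Phi> k"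
  shows "\<exists>\<rho> \<gamma>. 0 < \<rho> \<and> \<rho> < 1 \<and> 0 < \<gamma> \<and>
    (\<forall>\<^sub>F k in sequentially. \<Phi> k \<le> \<gamma> * \<rho> powi \<lceil>(real k - 1) / (real m + 1)\<rceil>)"
proof -
  define \<rho> where "\<rho> = 1 / (1 + c)"
  have \<rho>: "0 < \<rho>" "\<rho> < 1" using c by (auto simp: \<rho>_def)
  \<comment> \<open>Dividing by \<open>\<rho> ^ (K + 1)\<close> pays for the late start at
    \<open>K\<close> and for rounding the number of blocks up instead of down; the summand 1 keeps
    \<gamma> positive when \<open>\<Phi> K = 0\<close>.\<close>
  define \<gamma> where "\<gamma> = (\<Phi> K + 1) / \<rho> ^ (K + 1)"
  have \<gamma>: "0 < \<gamma>" using nonneg[of K] \<rho> by (simp add: \<gamma>_def)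
  have block: "\<Phi> (K + n * Suc m) \<le> \<Phi> K * \<rho> ^ n" for n
  proof (induction n)
    case (Suc n)
    have "\<Phi> (K + Suc n * Suc m) \<le> \<rho> * \<Phi> (K + n * Suc m)"
      using dec[of "K + n * Suc m"] c by (simp add: \<rho>_def field_simps)
    also have "\<dots> \<le> \<rho> * (\<Phi> K * \<rho> ^ n)" using Suc \<rho> by (intro mult_left_mono) auto
    finally show ?case by (simp add: mult_ac)
  qed simp
  have "\<Phi> k \<le> \<gamma> * \<rho> powi \<lceil>(real k - 1) / (real m + 1)\<rceil>" if k: "Suc K \<le> k" for k
  proof -
    define n where "n = (k - K) div Suc m"
    define N where "N = nat \<lceil>(real k - 1) / (real m + 1)\<rceil>"
    have N: "\<lceil>(real k - 1) / (real m + 1)\<rceil> = int N"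
    proof -
      have "0 \<le> (real k - 1) / (real m + 1)" using k by simp
      then have "0 \<le> \<lceil>(real k - 1) / (real m + 1)\<rceil>"
        by (metis ceiling_mono ceiling_zero)
      then show ?thesis by (simp add: N_def)
    qed
    have "k - K < (n + 1) * Suc m"
      unfolding n_def by (metis Suc_eq_plus1 dividend_less_div_times zero_less_Suc mult.commute mult_Suc_right add.commute mult_Suc)
    then have "k - 1 \<le> (n + 1) * Suc m + K" by linarith
    also have "\<dots> \<le> (n + 1 + K) * Suc m" by (simp add: algebra_simps)
    finally have "real (k - 1) \<le> real ((n + 1 + K) * Suc m)" by linarith
    then have "(real k - 1) / (real m + 1) \<le> real (n + 1 + K)"
      using k by (simp add: field_simps of_nat_diff)
    then have NK: "N \<le> n + (K + 1)"
      unfolding N_def by (simp add: ceiling_le_iff nat_le_iff)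
    have "\<Phi> k \<le> \<Phi> (K + n * Suc m)"
      using k by (intro antimonoD[OF anti]) (simp add: n_def, metis add_le_cancel_left div_times_less_eq_dividend le_add_diff_inverse less_or_eq_imp_le Suc_le_eq mult.commute mult_Suc_right)
    also have "\<dots> \<le> \<Phi> K * \<rho> ^ n" by (rule block)
    also have "\<dots> \<le> (\<Phi> K + 1) * \<rho> ^ n" using \<rho> by (intro mult_right_mono) auto
    also have "\<dots> = \<gamma> * \<rho> ^ (n + (K + 1))" using \<rho> by (simp add: \<gamma>_def power_add)
    also have "\<dots> \<le> \<gamma> * \<rho> ^ N"
      using NK \<rho> \<gamma> by (intro mult_left_mono power_decreasing) auto
    finally show ?thesis unfolding N by (simp add: power_int_of_nat)
  qed
  then have "\<forall>\<^sub>F k in sequentially. \<Phi> k \<le> \<gamma> * \<rho> powi \<lceil>(real k - 1) / (real m + 1)\<rceil>"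
    by (rule eventually_sequentiallyI)
  then show ?thesis using \<rho> \<gamma> by blast
qed

text \<open>Induction by contradiction: the map taking \<open>t\<close> to
  \<open>t + c * t powr q\<close> is increasing, so if the bound failed at \<open>Suc n\<close>, the
  recursion would force it to fail at \<open>n\<close>. The exponent \<open>r = 1 / (q - 1)\<close>
  is the one with \<open>r * q = r + 1\<close>, which makes the nonlinear term a
  \<open>1 / (n + 1)\<close> fraction of the bound.\<close>

lemma recursive_power_decay:
  fixes a :: "nat \<Rightarrow> real"
  assumes c: "0 < c" and q: "1 < q" and nonneg: "\<And>n. 0 \<le> a n"
    and dec: "\<And>n. a (Suc n) + c * a (Suc n) powr q \<le> a n"
  shows "\<exists>C>0. \<forall>n\<ge>1. a n \<le> C * real n powr (- (1 / (q - 1)))"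
proof -
  define r where "r = 1 / (q - 1)"
  have r: "0 < r" "r * q = r + 1" using q by (auto simp: r_def field_simps)
  \<comment> \<open>\<open>K\<close> controls the ratio of consecutive powers:
    \<open>exp (r * t) \<le> 1 + r * t * exp r\<close> for \<open>t = 1 / n\<close>, combined with
    \<open>1 / n \<le> 2 / (n + 1)\<close>.\<close>
  define K where "K = 2 * r * exp r"
  have K: "0 < K" using r by (simp add: K_def)
  \<comment> \<open>The first entry starts the induction at 1; the second makes
    \<open>c * C powr (q - 1)\<close> at least \<open>K\<close>, so that the decrease outweighs the
    ratio.\<close>
  define C where "C = max (a 1 + 1) ((K / c) powr r)"
  have C: "0 < C" "a 1 \<le> C" using nonneg[of 1] by (auto simp: C_def)
  have CK: "K \<le> c * C powr (q - 1)"
  proof -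
    have "K / c = ((K / c) powr r) powr (q - 1)"
      using K c q by (simp add: powr_powr r_def)
    also have "\<dots> \<le> C powr (q - 1)"
      using q K c by (intro powr_mono2) (auto simp: C_def)
    finally show ?thesis using c by (simp add: field_simps)
  qed
  have ratio: "(1 + 1 / real n) powr r \<le> 1 + K / (real n + 1)" if n: "1 \<le> n" for n
  proof -
    define t where "t = 1 / real n"
    have t: "0 < t" "t \<le> 1" using n by (auto simp: t_def)
    have "(1 + t) powr r = exp (r * ln (1 + t))" using t by (simp add: powr_def)
    also have "\<dots> \<le> exp (r * t)"
      using r t ln_add_one_self_le_self[of t] by simp
    also have "\<dots> \<le> 1 + (r * t) * exp (r * t)"
    proof -
      have "exp (r * t) * (1 - r * t) \<le> exp (r * t) * exp (- (r * t))"
        using exp_ge_add_one_self[of "- (r * t)"] by (intro mult_left_mono) auto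
      then show ?thesis by (simp add: exp_minus algebra_simps)
    qed
    also have "\<dots> \<le> 1 + (r * t) * exp r"
      using r t by (intro add_left_mono mult_left_mono) auto
    also have "\<dots> \<le> 1 + K / (real n + 1)"
    proof -
      have "t \<le> 2 / (real n + 1)" using n by (simp add: t_def field_simps)
      then have "r * exp r * t \<le> r * exp r * (2 / (real n + 1))"
        using r by (intro mult_left_mono) auto
      then show ?thesis by (simp add: K_def mult_ac)
    qed
    finally show ?thesis by (simp add: t_def)
  qed
  have "a n \<le> C * real n powr (- r)" if "1 \<le> n" for n
    using that
  proof (induction n rule: nat_induct_at_least)
    case base
    then show ?case using C by simp
  next
    case (Suc n)
    have n: "1 \<le> n" using Suc by simp
    show ?case
    proof (rule ccontr)
      define s where "s = (real n + 1) powr (- r)"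
      have s: "0 < s" using n by (simp add: s_def)
      assume "\<not> ?case"
      then have gt: "C * s < a (Suc n)" by (simp add: s_def add.commute)
      have "(C * s) powr q = C powr q * s powr q"
        using C s by (simp add: powr_mult)
      also have "C powr q = C * C powr (q - 1)"
        using C by (simp add: powr_diff)
      also have "s powr q = s / (real n + 1)"
      proof -
        have "s powr q = (real n + 1) powr (- r - 1)"
          using r by (simp add: s_def powr_powr) 
        then show ?thesis by (simp add: s_def powr_diff)
      qed
      finally have pw: "(C * s) powr q = C * C powr (q - 1) * (s / (real n + 1))" .
      have "C * real n powr (- r) = C * s * (1 + 1 / real n) powr r"
      proof -
        have "1 + 1 / real n = (real n + 1) / real n" using n by (simp add: field_simps)
        then have "s * (1 + 1 / real n) powr r = real n powr (- r)"
          using n by (simp add: s_def powr_divide powr_minus field_simps)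
        then show ?thesis by simp
      qed
      also have "\<dots> \<le> C * s * (1 + K / (real n + 1))"
        using C s ratio[OF n] by (intro mult_left_mono) auto
      also have "\<dots> \<le> C * s * (1 + c * C powr (q - 1) / (real n + 1))"
        using C s CK by (intro mult_left_mono add_left_mono divide_right_mono) auto
      also have "\<dots> = C * s + c * (C * s) powr q"
        unfolding pw by (simp add: algebra_simps)
      also have "\<dots> < a (Suc n) + c * a (Suc n) powr q"
        using gt C s c q by (intro add_less_le_mono mult_left_mono powr_mono2) auto
      also have "\<dots> \<le> a n" by (rule dec)
      finally show False using Suc by simp
    qed
  qed
  then show ?thesis using C unfolding r_def by blast
qed

text \<open>Sampling along the stride \<open>Suc m\<close> reduces to a one-step recursion;
  monotonicity fills in the indices between samples.\<close>

lemma sublinear_rate_of_block_decrease: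
  fixes \<Phi> :: "nat \<Rightarrow> real"
  assumes c: "0 < c" and q: "1 < q" and nonneg: "\<And>k. 0 \<le> \<Phi> k" and anti: "antimono \<Phi>"
    and dec: "\<And>k. K \<le> k \<Longrightarrow> \<Phi> (k + Suc m) + c * \<Phi> (k + Suc m) powr q \<le> \<Phi> k"
  shows "\<exists>\<gamma>>0. \<forall>\<^sub>F k in sequentially. \<Phi> k \<le> \<gamma> * real k powr (- (1 / (q - 1)))"
proof -
  define r where "r = 1 / (q - 1)"
  have r: "0 < r" using q by (simp add: r_def)
  obtain C where C: "0 < C" "\<And>n. 1 \<le> n \<Longrightarrow> \<Phi> (K + n * Suc m) \<le> C * real n powr (- r)"
  proof -
    have "\<Phi> (K + Suc n * Suc m) + c * \<Phi> (K + Suc n * Suc m) powr q \<le> \<Phi> (K + n * Suc m)" for n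
    proof -
      have "K + Suc n * Suc m = (K + n * Suc m) + Suc m" by simp
      then show ?thesis using dec[of "K + n * Suc m"] by (metis le_add1)
    qed
    then show thesis
      using recursive_power_decay[OF c q, of "\<lambda>n. \<Phi> (K + n * Suc m)"] nonneg that
      unfolding r_def by blast
  qed
  \<comment> \<open>For \<open>k \<ge> 2 * K + Suc m\<close>, with \<open>n\<close> complete blocks
    after \<open>K\<close>, one has \<open>k \<le> 2 * (k - K)\<close> and
    \<open>k - K \<le> 2 * n * Suc m\<close>, hence the factor \<open>4 * Suc m\<close>.\<close>
  define \<gamma> where "\<gamma> = C * (4 * real (Suc m)) powr r"
  have "0 < \<gamma>" using C by (simp add: \<gamma>_def)
  moreover have "\<Phi> k \<le> \<gamma> * real k powr (- r)" if k: "2 * K + Suc m \<le> k" for k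
  proof -
    define n where "n = (k - K) div Suc m"
    have decomp: "k - K = n * Suc m + (k - K) mod Suc m" "(k - K) mod Suc m < Suc m"
      unfolding n_def by (simp_all only: div_mult_mod_eq) simp
    have n: "1 \<le> n"
      using k decomp by (cases n) auto
    have "k \<le> 2 * (k - K)" using k by linarith
    also have "\<dots> \<le> 2 * (n * Suc m + Suc m)"
      using decomp by (metis add_le_cancel_left less_imp_le mult_le_mono2)
    also have "\<dots> \<le> 4 * Suc m * n" using n by (cases n) (auto simp: algebra_simps)
    finally have "real k \<le> real (4 * Suc m * n)" by (rule of_nat_mono)
    then have kn: "real k / (4 * real (Suc m)) \<le> real n" by (simp add: field_simps)
    have k0: "0 < real k" using k by simp
    have "\<Phi> k \<le> \<Phi> (K + n * Suc m)"
      using k decomp by (intro antimonoD[OF anti]) linarith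
    also have "\<dots> \<le> C * real n powr (- r)" by (rule C(2)[OF n])
    also have "\<dots> \<le> C * (real k / (4 * real (Suc m))) powr (- r)"
      using C(1) kn k0 r by (intro mult_left_mono powr_mono2') auto
    also have "\<dots> = \<gamma> * real k powr (- r)"
      using k0 by (simp add: \<gamma>_def powr_divide powr_minus field_simps)
    finally show ?thesis .
  qed
  then have "\<forall>\<^sub>F k in sequentially. \<Phi> k \<le> \<gamma> * real k powr (- r)"
    by (rule eventually_sequentiallyI)
  ultimately show ?thesis unfolding r_def by blast
qed

subsection \<open>The iterates of PGenls\<close>

text \<open>The derivative of the desingularizing function is
  \<open>c * (1 - \<theta>) * t powr (- \<theta>)\<close>, and any single element of
  \<open>S\<close> bounds the distance to \<open>S\<close> from above. One explicit subgradient is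
  thus enough to exploit the KL property.\<close>

lemma KL_inequality_norm_bound:
  fixes S :: "'a::euclidean_space set"
  assumes t: "0 < t" and c: "0 < c" and \<theta>: "\<theta> < 1"
    and KL: "1 \<le> ereal (deriv (\<lambda>t. c * t powr (1 - \<theta>)) t) * edist_set 0 S" and v: "v \<in> S"
  shows "t powr \<theta> \<le> c * (1 - \<theta>) * norm v"
proof -
  have "((\<lambda>t. c * t powr (1 - \<theta>)) has_real_derivative c * ((1 - \<theta>) * t powr (1 - \<theta> - 1))) (at t)"
    using t by (intro DERIV_cmult has_real_derivative_powr)
  then have deriv: "deriv (\<lambda>t. c * t powr (1 - \<theta>)) t = c * (1 - \<theta>) * t powr (- \<theta>)"
    by (simp add: DERIV_imp_deriv)
  have "edist_set 0 S \<le> ereal (norm v)"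
    unfolding edist_set_def using INF_lower[OF v, of "\<lambda>v. ereal (dist 0 v)"] by simp
  then have "ereal (c * (1 - \<theta>) * t powr (- \<theta>)) * edist_set 0 S
      \<le> ereal (c * (1 - \<theta>) * t powr (- \<theta>)) * ereal (norm v)"
    using c \<theta> by (intro ereal_mult_left_mono) auto
  then have "ereal 1 \<le> ereal (c * (1 - \<theta>) * t powr (- \<theta>)) * ereal (norm v)"
    using KL unfolding deriv one_ereal_def by (rule order_trans[rotated])
  then have "1 \<le> c * (1 - \<theta>) * t powr (- \<theta>) * norm v" by simp
  then have "t powr \<theta> * 1 \<le> t powr \<theta> * (c * (1 - \<theta>) * t powr (- \<theta>) * norm v)"
    by (intro mult_left_mono) auto
  also have "\<dots> = c * (1 - \<theta>) * norm v * (t powr \<theta> * t powr (- \<theta>))" by (simp only: mult_ac)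
  also have "t powr \<theta> * t powr (- \<theta>) = 1" using t by (simp add: powr_minus)
  finally show ?thesis by simp
qed

lemma lsc_fun_le_lim:
  assumes "lsc_fun h" and "s \<longlonglongrightarrow> xb" and "(\<lambda>n. h (s n)) \<longlonglongrightarrow> l"
  shows "h xb \<le> l"
proof (rule ccontr)
  assume "\<not> h xb \<le> l"
  then obtain c where c: "l < c" "c < h xb" using dense[of l "h xb"] by (auto simp: not_le)
  have "\<forall>\<^sub>F y in at xb. c < h y"
    using assms(1) c(2) unfolding lsc_fun_def le_Liminf_iff by blast
  \<comment> \<open>The filter \<open>at xb\<close> omits \<open>xb\<close>, but the sequence may
    take this value; \<open>c < h xb\<close> covers that case.\<close>
  then have "\<forall>\<^sub>F y in nhds xb. c < h y"
    using c(2) unfolding eventually_at_filter by (auto elim: eventually_mono)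
  then have "\<forall>\<^sub>F n in sequentially. c < h (s n)"
    using assms(2) by (auto dest: filterlim_iff[THEN iffD1])
  moreover have "\<forall>\<^sub>F n in sequentially. h (s n) < c"
    using assms(3) c(1) by (rule order_tendstoD)
  ultimately have "\<forall>\<^sub>F n in sequentially. False"
    by eventually_elim simp
  then show False by simp
qed

section \<open>One-step estimates for a fixed run of the algorithm\<close>

locale PGenls_run =
  fixes f :: "'a::euclidean_space \<Rightarrow> real" and g :: "'a \<Rightarrow> ereal"
    and L \<delta> \<alpha> \<tau>min \<tau>max \<beta>max \<eta>1 \<eta>2 :: real and m :: nat and x :: "nat \<Rightarrow> 'a"
  assumes smooth: "L_smooth L f" and proper: "proper_fun g"
    and lsc: "lsc_fun (composite f g)" and coercive: "coercive_fun (composite f g)"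
    and bounded_below: "bounded_below_fun (composite f g)"
    and \<delta>: "0 < \<delta>" "\<delta> < 1 / 2" and \<alpha>: "0 < \<alpha>" and \<tau>min: "0 < \<tau>min" and \<beta>max: "0 \<le> \<beta>max"
    and \<eta>1: "0 < \<eta>1" "\<eta>1 < 1"
    and sequence: "PGenls_sequence f g m \<delta> \<alpha> \<tau>min \<tau>max \<beta>max \<eta>1 \<eta>2 x"
begin

abbreviation "F \<equiv> composite f g"

definition Fval :: "nat \<Rightarrow> real" where "Fval k = real_of_ereal (F (x k))"

text \<open>Truncated subtraction gives \<open>d 0 = 0\<close>, in agreement with the convention
  that the point before \<open>x 0\<close> is \<open>x 0\<close> itself.\<close>

definition d :: "nat \<Rightarrow> real" where "d k = norm (x k - x (k - 1))"

text \<open>The squared product norm of \<open>z_iter x (Suc k) - z_iter x k\<close>, that is, the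
  quantity in the acceptance test.\<close>

definition e :: "nat \<Rightarrow> real" where "e k = (d (Suc k))\<^sup>2 + (d k)\<^sup>2"

definition h :: "nat \<Rightarrow> real" where "h k = Fval k + \<delta> / 2 * (d k)\<^sup>2"

abbreviation "M k \<equiv> Max (h ` {k - m..k})"

lemma L_nonneg: "0 \<le> L"
  using smooth by (rule L_smooth_nonneg)

lemma d_nonneg: "0 \<le> d k" and e_nonneg: "0 \<le> e k"
  by (auto simp: d_def e_def)

text \<open>Keeps what the estimates use of the accepted pass: backtracking never takes the step
  size below \<tau>min or the extrapolation weight above \<beta>max, so \<open>y\<close> stays
  within a multiple of the last step.\<close>

lemma step:
  obtains y \<tau> where "\<tau>min \<le> \<tau>" "norm (x k - y) \<le> \<beta>max * d k"
    "norm (x (Suc k) - y) \<le> d (Suc k) + \<beta>max * d k"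
    "x (Suc k) \<in> prox \<tau> g (y - \<tau> *\<^sub>R grad f y)"
    "PGenls_accept F m \<delta> \<alpha> x k (x (Suc k))"
proof -
  have "PGenls_step f g m \<delta> \<alpha> \<tau>min \<tau>max \<beta>max \<eta>1 \<eta>2 x k"
    using sequence by (simp add: PGenls_sequence_def)
  then obtain \<beta>0 \<tau>0 p N where \<beta>0: "\<beta>0 \<in> {0..\<beta>max}"
    and loop: "\<forall>l\<le>N. let \<beta> = \<beta>0 * \<eta>1 ^ l; \<tau> = max (\<tau>0 * \<eta>2 ^ l) \<tau>min;
        y = x k + \<beta> *\<^sub>R (x k - x (k - 1)) in p l \<in> prox \<tau> g (y - \<tau> *\<^sub>R grad f y)"
    and accept: "PGenls_accept F m \<delta> \<alpha> x k (p N)" and p: "x (Suc k) = p N"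
    unfolding PGenls_step_def by blast
  define \<beta> \<tau> y where "\<beta> = \<beta>0 * \<eta>1 ^ N" and "\<tau> = max (\<tau>0 * \<eta>2 ^ N) \<tau>min"
    and "y = x k + \<beta> *\<^sub>R (x k - x (k - 1))"
  have prox: "x (Suc k) \<in> prox \<tau> g (y - \<tau> *\<^sub>R grad f y)"
    using loop p unfolding Let_def \<beta>_def \<tau>_def y_def by auto
  have "0 \<le> \<beta>" "\<beta> \<le> \<beta>max"
  proof -
    have "\<eta>1 ^ N \<le> 1" using \<eta>1 by (simp add: power_le_one)
    then have "\<beta>0 * \<eta>1 ^ N \<le> \<beta>0 * 1" using \<beta>0 by (intro mult_left_mono) auto
    then show "0 \<le> \<beta>" "\<beta> \<le> \<beta>max" using \<beta>0 \<eta>1 by (auto simp: \<beta>_def)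
  qed
  then have xy: "norm (x k - y) \<le> \<beta>max * d k"
    by (simp add: y_def d_def mult_right_mono)
  moreover have "norm (x (Suc k) - y) \<le> d (Suc k) + \<beta>max * d k"
    using norm_triangle_ineq[of "x (Suc k) - x k" "x k - y"] xy by (simp add: d_def)
  ultimately show thesis
    using prox accept p by (intro that[of \<tau> y]) (auto simp: \<tau>_def)
qed

lemma F_eq_Fval: "F (x k) = ereal (Fval k)"
proof -
  have "g (x k) \<noteq> \<infinity>"
  proof (cases k)
    case 0
    then show ?thesis using sequence by (auto simp: PGenls_sequence_def dom_fun_def)
  next
    case (Suc k')
    then show ?thesis using prox_finite[OF _ proper] step[of k'] by blast
  qed
  then show ?thesis
    using proper_funD[OF proper, of "x k"] unfolding Fval_def composite_def by (cases "g (x k)") auto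
qed

lemma H_fun_eq_h: "H_fun F \<delta> (z_iter x k) = ereal (h k)"
  by (simp add: H_fun_def z_iter_def F_eq_Fval h_def d_def)

lemma descent: "h (Suc k) \<le> M k - \<alpha> / 2 * e k"
proof -
  obtain y \<tau> where "PGenls_accept F m \<delta> \<alpha> x k (x (Suc k))" by (rule step[of k]) blast
  moreover have "(x (Suc k), x k) = z_iter x (Suc k)" by (simp add: z_iter_def)
  moreover have "(norm (z_iter x (Suc k) - z_iter x k))\<^sup>2 = e k"
    by (simp add: z_iter_def norm_Pair e_def d_def)
  moreover have "Max ((\<lambda>j. ereal (h j)) ` {k - m..k}) = ereal (M k)"
    using mono_Max_commute[of ereal "h ` {k - m..k}"] by (simp add: mono_def image_image)
  ultimately show ?thesis by (simp add: PGenls_accept_def H_fun_eq_h)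
qed

text \<open>The summands bound, in this order, the linearization error of \<open>f\<close>, the
  quadratic prox term of the competitor \<open>x k\<close>, and the penalty in
  \<open>h (Suc k)\<close>, each as a multiple of \<open>e k\<close>.\<close>

definition C where "C = L * (1 + \<beta>max) + \<beta>max\<^sup>2 / (2 * \<tau>min) + \<delta> / 2"

lemma C_nonneg: "0 \<le> C"
  using L_nonneg \<beta>max \<tau>min \<delta> by (simp add: C_def)

text \<open>Comparing the prox point with \<open>z = x k\<close> bounds how much \<open>F\<close> can increase in one step; this
  one-sided estimate replaces the continuity of \<open>F\<close> in the usual nonmonotone line-search argument.\<close>

lemma backward: "h (Suc k) \<le> h k + C * e k"
proof -
  obtain y \<tau> where y: "\<tau>min \<le> \<tau>" "norm (x k - y) \<le> \<beta>max * d k"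
    "norm (x (Suc k) - y) \<le> d (Suc k) + \<beta>max * d k"
    "x (Suc k) \<in> prox \<tau> g (y - \<tau> *\<^sub>R grad f y)"
    by (rule step[of k]) blast
  have \<tau>: "0 < \<tau>" using y \<tau>min by simp
  have "Fval (Suc k) \<le> Fval k + (L * (norm (x (Suc k) - y) + norm (x k - y)) * d (Suc k)
      + (norm (x k - y))\<^sup>2 / (2 * \<tau>))"
    using composite_prox_gradient_le[OF smooth proper \<tau> y(4), of "x k"]
    by (simp add: F_eq_Fval d_def)
  also have "L * (norm (x (Suc k) - y) + norm (x k - y)) * d (Suc k) \<le> L * ((1 + \<beta>max) * e k)"
  proof -
    have "(norm (x (Suc k) - y) + norm (x k - y)) * d (Suc k)
        \<le> (d (Suc k) + 2 * (\<beta>max * d k)) * d (Suc k)"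
      using y d_nonneg by (intro mult_right_mono) auto
    also have "\<dots> = (d (Suc k))\<^sup>2 + \<beta>max * (2 * d k * d (Suc k))"
      by (simp add: power2_eq_square algebra_simps)
    also have "\<dots> \<le> e k + \<beta>max * e k"
      using sum_squares_bound[of "d k" "d (Suc k)"] \<beta>max
      by (intro add_mono mult_left_mono) (auto simp: e_def)
    finally have "(norm (x (Suc k) - y) + norm (x k - y)) * d (Suc k) \<le> (1 + \<beta>max) * e k"
      by (simp add: distrib_right)
    then show ?thesis using L_nonneg by (simp only: mult.assoc mult_left_mono)
  qed
  also have "(norm (x k - y))\<^sup>2 / (2 * \<tau>) \<le> (\<beta>max * d k)\<^sup>2 / (2 * \<tau>min)"
    using y \<tau>min by (intro frac_le power_mono) auto
  also have "\<dots> \<le> \<beta>max\<^sup>2 / (2 * \<tau>min) * e k"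
  proof -
    have "\<beta>max\<^sup>2 / (2 * \<tau>min) * (d k)\<^sup>2 \<le> \<beta>max\<^sup>2 / (2 * \<tau>min) * e k"
      using \<tau>min by (intro mult_left_mono) (auto simp: e_def)
    then show ?thesis by (simp add: power_mult_distrib)
  qed
  finally have "Fval (Suc k) \<le> Fval k + (L * ((1 + \<beta>max) * e k) + \<beta>max\<^sup>2 / (2 * \<tau>min) * e k)"
    by simp
  moreover have "\<delta> / 2 * (d (Suc k))\<^sup>2 \<le> \<delta> / 2 * e k"
    using \<delta> by (intro mult_left_mono) (auto simp: e_def)
  moreover have "0 \<le> \<delta> / 2 * (d k)\<^sup>2" using \<delta> by simp
  moreover have "C * e k = L * ((1 + \<beta>max) * e k) + \<beta>max\<^sup>2 / (2 * \<tau>min) * e k + \<delta> / 2 * e k"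
    by (simp add: C_def algebra_simps)
  ultimately show ?thesis unfolding h_def by linarith
qed

lemma Fval_le_h: "Fval k \<le> h k"
  using \<delta> by (simp add: h_def)

lemma h_le_M: "h k \<le> M k"
  by (simp add: Max_ge)

lemma M_antimono: "antimono (\<lambda>k. M k)"
proof (rule nonmonotone_max_antimono)
  show "h (Suc k) \<le> M k - \<alpha> / 2 * e k" for k by (rule descent)
  show "0 \<le> \<alpha> / 2 * e k" for k using \<alpha> e_nonneg by simp
qed

lemma convergence:
  obtains \<omega> where "h \<longlonglongrightarrow> \<omega>" "Fval \<longlonglongrightarrow> \<omega>" "e \<longlonglongrightarrow> 0" "d \<longlonglongrightarrow> 0" "\<And>k. \<omega> \<le> M k"
proof -
  obtain b where b: "\<And>z. ereal b \<le> F z"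
    using bounded_below unfolding bounded_below_fun_def by blast
  have "b \<le> h k" for k
    using b[of "x k"] Fval_le_h[of k] by (simp add: F_eq_Fval)
  moreover have "0 < \<alpha> / 2" using \<alpha> by simp
  ultimately obtain \<omega> where \<omega>: "h \<longlonglongrightarrow> \<omega>" "e \<longlonglongrightarrow> 0" "\<And>k. \<omega> \<le> M k"
    using nonmonotone_descent_convergence[OF _ C_nonneg e_nonneg descent backward, of b]
    by blast
  have d2: "(\<lambda>k. (d k)\<^sup>2) \<longlonglongrightarrow> 0"
    by (rule real_tendsto_sandwich[OF _ _ tendsto_const \<omega>(2)]) (auto simp: e_def)
  from tendsto_real_sqrt[OF d2] have "d \<longlonglongrightarrow> 0" using d_nonneg by simp
  moreover from tendsto_diff[OF \<omega>(1) tendsto_mult_left[OF d2, of "\<delta> / 2"]]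
  have "Fval \<longlonglongrightarrow> \<omega>" by (simp add: h_def)
  ultimately show thesis using \<omega> by (intro that)
qed

section \<open>Cluster points and the KL inequality along the iterates\<close>

text \<open>Since \<open>Fval k \<le> M k \<le> M 0\<close>, all iterates lie in one sublevel set of
  \<open>F\<close>, which coercivity makes bounded.\<close>

lemma bounded_iterates: "bounded (range x)"
proof -
  have "\<forall>\<^sub>F z in at_infinity. ereal (M 0) < F z"
    using coercive unfolding coercive_fun_def tendsto_PInfty by blast
  then obtain b where b: "\<And>z. b \<le> norm z \<Longrightarrow> ereal (M 0) < F z"
    unfolding eventually_at_infinity by blast
  have "norm (x k) \<le> b" for k
  proof (rule ccontr)
    assume "\<not> norm (x k) \<le> b"
    then have "M 0 < Fval k" using b[of "x k"] by (simp add: F_eq_Fval)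
    then show False
      using Fval_le_h[of k] h_le_M[of k] antimonoD[OF M_antimono le0, of k] by linarith
  qed
  then show ?thesis by (auto simp: bounded_iff)
qed

lemma subgradient_bound:
  obtains v where "v \<in> frechet_subdiff F (x (Suc k))"
    "norm v \<le> (L + 1 / \<tau>min) * (1 + \<beta>max) * (d (Suc k) + d k)"
proof -
  obtain y \<tau> where y: "\<tau>min \<le> \<tau>" "norm (x (Suc k) - y) \<le> d (Suc k) + \<beta>max * d k"
    "x (Suc k) \<in> prox \<tau> g (y - \<tau> *\<^sub>R grad f y)"
    by (rule step[of k]) blast
  have \<tau>: "0 < \<tau>" using y \<tau>min by simp
  let ?v = "grad f (x (Suc k)) - grad f y - (1 / \<tau>) *\<^sub>R (x (Suc k) - y)"
  have "norm ?v \<le> norm (grad f (x (Suc k)) - grad f y) + norm ((1 / \<tau>) *\<^sub>R (x (Suc k) - y))"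
    by (rule norm_triangle_ineq4)
  also have "\<dots> \<le> L * norm (x (Suc k) - y) + 1 / \<tau>min * norm (x (Suc k) - y)"
  proof (rule add_mono)
    have "norm ((1 / \<tau>) *\<^sub>R (x (Suc k) - y)) = 1 / \<tau> * norm (x (Suc k) - y)"
      using \<tau> by simp
    also have "\<dots> \<le> 1 / \<tau>min * norm (x (Suc k) - y)"
      using \<tau>min y(1) by (intro mult_right_mono frac_le) auto
    finally show "norm ((1 / \<tau>) *\<^sub>R (x (Suc k) - y)) \<le> 1 / \<tau>min * norm (x (Suc k) - y)" .
  qed (rule L_smooth_norm_grad_diff[OF smooth])
  also have "\<dots> = (L + 1 / \<tau>min) * norm (x (Suc k) - y)" by (simp add: algebra_simps)
  also have "\<dots> \<le> (L + 1 / \<tau>min) * ((1 + \<beta>max) * (d (Suc k) + d k))"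
  proof (rule mult_left_mono)
    have "d (Suc k) + \<beta>max * d k \<le> (1 + \<beta>max) * (d (Suc k) + d k)"
      using \<beta>max d_nonneg[of k] d_nonneg[of "Suc k"] by (simp add: algebra_simps)
    then show "norm (x (Suc k) - y) \<le> (1 + \<beta>max) * (d (Suc k) + d k)" using y by simp
    show "0 \<le> L + 1 / \<tau>min" using L_nonneg \<tau>min by simp
  qed
  finally show thesis
    using prox_gradient_frechet_subdiff[OF smooth proper \<tau> y(3)] by (intro that) (auto simp: mult.assoc)
qed

text \<open>Lower semicontinuity gives only \<open>F xb \<le> \<omega>\<close>. The reverse
  inequality comes from testing the minimality of the prox points against \<open>xb\<close>.
  Convergence of the values is also what lets the vanishing Frechet subgradients pass to a limiting
  one.\<close>

lemma cluster_point:
  assumes \<omega>: "Fval \<longlonglongrightarrow> \<omega>" and d0: "d \<longlonglongrightarrow> 0"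
    and s: "filterlim s at_top sequentially" and xb: "(\<lambda>n. x (Suc (s n))) \<longlonglongrightarrow> xb"
  shows "F xb = ereal \<omega>" "0 \<in> limiting_subdiff F xb"
proof -
  note ds = filterlim_compose[OF d0 s] filterlim_compose[OF LIMSEQ_Suc[OF d0] s]
  have Fs: "(\<lambda>n. Fval (Suc (s n))) \<longlonglongrightarrow> \<omega>"
    by (rule filterlim_compose[OF LIMSEQ_Suc[OF \<omega>] s])
  then have Fs': "(\<lambda>n. F (x (Suc (s n)))) \<longlonglongrightarrow> ereal \<omega>"
    by (simp add: F_eq_Fval tendsto_ereal)
  have upper: "F xb \<le> ereal \<omega>" using lsc_fun_le_lim[OF lsc xb Fs'] .
  have "F xb \<noteq> -\<infinity>" using proper_funD[OF proper, of xb] by (cases "g xb") (auto simp: composite_def)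
  with upper obtain r where r: "F xb = ereal r" by (cases "F xb") auto
  define b where "b n = norm (x (Suc (s n)) - xb)" for n
  have b0: "b \<longlonglongrightarrow> 0" unfolding b_def using xb by (simp add: tendsto_norm_zero_iff LIM_zero)
  \<comment> \<open>\<open>a n\<close> bounds the distance from \<open>xb\<close> to the
    extrapolated point through the triangle inequality, and \<open>err n\<close> is the resulting
    excess in the prox comparison.\<close>
  define a where "a n = b n + d (Suc (s n)) + \<beta>max * d (s n)" for n
  define err where "err n = L * (d (Suc (s n)) + \<beta>max * d (s n) + a n) * b n + (a n)\<^sup>2 / (2 * \<tau>min)" for n
  have "Fval (Suc (s n)) \<le> r + err n" for n
  proof -
    obtain y \<tau> where y: "\<tau>min \<le> \<tau>" "norm (x (s n) - y) \<le> \<beta>max * d (s n)"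
      "norm (x (Suc (s n)) - y) \<le> d (Suc (s n)) + \<beta>max * d (s n)"
      "x (Suc (s n)) \<in> prox \<tau> g (y - \<tau> *\<^sub>R grad f y)"
      by (rule step[of "s n"]) blast
    have \<tau>: "0 < \<tau>" using y \<tau>min by simp
    have xby: "norm (xb - y) \<le> a n"
      using norm_triangle_ineq[of "xb - x (Suc (s n))" "x (Suc (s n)) - y"] y
      by (simp add: a_def b_def norm_minus_commute)
    have "Fval (Suc (s n)) \<le> r + (L * (norm (x (Suc (s n)) - y) + norm (xb - y)) * b n
        + (norm (xb - y))\<^sup>2 / (2 * \<tau>))"
      using composite_prox_gradient_le[OF smooth proper \<tau> y(4), of xb]
      by (simp add: F_eq_Fval r b_def)
    also have "\<dots> \<le> r + err n"
      unfolding err_def using y xby L_nonneg \<tau>min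
      by (intro add_left_mono add_mono mult_right_mono mult_left_mono frac_le power_mono)
        (auto simp: b_def)
    finally show ?thesis .
  qed
  moreover have "(\<lambda>n. r + err n) \<longlonglongrightarrow> r + 0"
  proof (intro tendsto_add tendsto_const)
    have "a \<longlonglongrightarrow> 0 + 0 + \<beta>max * 0"
      unfolding a_def by (intro tendsto_intros b0 ds)
    then have "err \<longlonglongrightarrow> L * (0 + \<beta>max * 0 + 0) * 0 + 0\<^sup>2 / (2 * \<tau>min)"
      unfolding err_def using \<tau>min by (intro tendsto_intros b0 ds) auto
    then show "err \<longlonglongrightarrow> 0" by simp
  qed
  ultimately have "\<omega> \<le> r"
    using LIMSEQ_le[OF Fs, of "\<lambda>n. r + err n" r] by simp
  then show F: "F xb = ereal \<omega>" using upper r by simp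
  have "\<forall>n. \<exists>v. v \<in> frechet_subdiff F (x (Suc (s n)))
      \<and> norm v \<le> (L + 1 / \<tau>min) * (1 + \<beta>max) * (d (Suc (s n)) + d (s n))"
    using subgradient_bound by metis
  then obtain vs where vs: "\<And>n. vs n \<in> frechet_subdiff F (x (Suc (s n)))"
    "\<And>n. norm (vs n) \<le> (L + 1 / \<tau>min) * (1 + \<beta>max) * (d (Suc (s n)) + d (s n))"
    by metis
  have "(\<lambda>n. (L + 1 / \<tau>min) * (1 + \<beta>max) * (d (Suc (s n)) + d (s n))) \<longlonglongrightarrow> (L + 1 / \<tau>min) * (1 + \<beta>max) * (0 + 0)"
    by (intro tendsto_intros ds)
  then have bound: "(\<lambda>n. (L + 1 / \<tau>min) * (1 + \<beta>max) * (d (Suc (s n)) + d (s n))) \<longlonglongrightarrow> 0"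
    by simp
  have "vs \<longlonglongrightarrow> 0"
    by (rule Lim_null_comparison[OF _ bound]) (simp add: vs(2))
  then show "0 \<in> limiting_subdiff F xb"
    unfolding limiting_subdiff_def using F xb Fs' vs(1)
    by (intro CollectI conjI exI[of _ "\<lambda>n. x (Suc (s n))"] exI[of _ vs]) simp_all
qed

text \<open>A uniform KL inequality along the iterates: if the constants had to blow up along a
  subsequence, the KL inequality at one of its cluster points would be violated.\<close>

lemma KL_along_iterates:
  assumes KL: "KL_function F \<theta>" and \<omega>: "Fval \<longlonglongrightarrow> \<omega>" and d0: "d \<longlonglongrightarrow> 0"
  shows "\<exists>K::nat. \<forall>\<^sub>F k in sequentially. \<omega> < Fval (Suc k) \<longrightarrow>
    (Fval (Suc k) - \<omega>) powr \<theta> \<le> real K * (d (Suc k) + d k)"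
proof (rule ccontr)
  assume "\<not> ?thesis"
  \<comment> \<open>The negation is used with the constant \<open>n\<close> and with an index beyond
    \<open>n\<close>, so the bad indices tend to infinity together with the constants they
    violate.\<close>
  then have "\<forall>n. \<exists>k\<ge>n. \<omega> < Fval (Suc k) \<and>
      real n * (d (Suc k) + d k) < (Fval (Suc k) - \<omega>) powr \<theta>"
    unfolding eventually_sequentially by (auto simp: not_le)
  then obtain s where s: "\<And>n. n \<le> s n" "\<And>n. \<omega> < Fval (Suc (s n))"
    "\<And>n. real n * (d (Suc (s n)) + d (s n)) < (Fval (Suc (s n)) - \<omega>) powr \<theta>"
    by metis
  have "bounded (range (\<lambda>n. x (Suc (s n))))"
    by (rule bounded_subset[OF bounded_iterates]) auto
  then obtain xb r where r: "strict_mono r" "((\<lambda>n. x (Suc (s n))) \<circ> r) \<longlonglongrightarrow> xb"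
    using bounded_imp_convergent_subsequence by blast
  have xb: "(\<lambda>n. x (Suc (s (r n)))) \<longlonglongrightarrow> xb" using r(2) by (simp add: o_def)
  have nr: "n \<le> r n" for n using r(1) by (rule seq_suble)
  have sr: "filterlim (\<lambda>n. s (r n)) at_top sequentially"
    using s(1) nr by (intro filterlim_at_top_mono[OF filterlim_ident] always_eventually allI)
      (metis order_trans)
  note cluster = cluster_point[OF \<omega> d0 sr xb]
  have \<theta>: "\<theta> < 1" using KL by (simp add: KL_function_def)
  obtain c \<eta> U where c: "0 < c" and \<eta>: "0 < \<eta>" and U: "open U" "xb \<in> U"
    and ineq: "\<And>z. z \<in> U \<Longrightarrow> F xb < F z \<Longrightarrow> F z < F xb + \<eta> \<Longrightarrow>
      1 \<le> ereal (deriv (\<lambda>t. c * t powr (1 - \<theta>)) (real_of_ereal (F z - F xb)))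
        * edist_set 0 (limiting_subdiff F z)"
    using KL cluster(2) unfolding KL_function_def by (metis empty_iff)
  have "\<forall>\<^sub>F n in sequentially. x (Suc (s (r n))) \<in> U"
    using xb U by (rule topological_tendstoD)
  moreover have "\<forall>\<^sub>F n in sequentially. F (x (Suc (s (r n)))) < F xb + \<eta>"
  proof -
    have "(\<lambda>n. F (x (Suc (s (r n))))) \<longlonglongrightarrow> ereal \<omega>"
      using filterlim_compose[OF LIMSEQ_Suc[OF \<omega>] sr] by (simp add: F_eq_Fval tendsto_ereal)
    moreover have "ereal \<omega> < F xb + \<eta>" using \<eta> unfolding cluster(1) by (cases \<eta>) auto
    ultimately show ?thesis by (rule order_tendstoD)
  qed
  \<comment> \<open>The constant that the KL inequality at \<open>xb\<close> and the subgradient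
    bound provide on \<open>U\<close>. Once \<open>B \<le> n \<le> r n\<close>, the choice of the
    bad indices is contradicted.\<close>
  moreover define B where "B = c * (1 - \<theta>) * ((L + 1 / \<tau>min) * (1 + \<beta>max))"
  have "\<forall>\<^sub>F n in sequentially. B \<le> real n"
    using filterlim_real_sequentially unfolding filterlim_at_top by blast
  ultimately have "\<forall>\<^sub>F n::nat in sequentially. False"
  proof eventually_elim
    case (elim n)
    define k where "k = s (r n)"
    define t where "t = Fval (Suc k) - \<omega>"
    have t: "0 < t" using s(2)[of "r n"] by (simp add: t_def k_def)
    obtain v where v: "v \<in> frechet_subdiff F (x (Suc k))"
      "norm v \<le> (L + 1 / \<tau>min) * (1 + \<beta>max) * (d (Suc k) + d k)"
      by (rule subgradient_bound)
    have "1 \<le> ereal (deriv (\<lambda>t. c * t powr (1 - \<theta>)) t) * edist_set 0 (limiting_subdiff F (x (Suc k)))"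
      using ineq[of "x (Suc k)"] elim t by (simp add: k_def t_def cluster(1) F_eq_Fval)
    then have "t powr \<theta> \<le> c * (1 - \<theta>) * norm v"
      using KL_inequality_norm_bound[OF t c \<theta>] v(1) frechet_subset_limiting_subdiff by blast
    also have "\<dots> \<le> c * (1 - \<theta>) * ((L + 1 / \<tau>min) * (1 + \<beta>max) * (d (Suc k) + d k))"
      using c \<theta> v(2) by (intro mult_left_mono) auto
    also have "\<dots> = B * (d (Suc k) + d k)" by (simp add: B_def)
    also have "\<dots> \<le> real (r n) * (d (Suc k) + d k)"
      using elim nr[of n] d_nonneg by (intro mult_right_mono) (auto intro: order_trans)
    also have "\<dots> < t powr \<theta>" using s(3)[of "r n"] by (simp add: k_def t_def)
    finally show False by simp
  qed
  then show False by simp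
qed

text \<open>The excess of \<open>h\<close> has two parts. The excess of \<open>F\<close> is handled
  by squaring the KL estimate, since \<open>(d (Suc k) + d k)\<^sup>2 \<le> 2 * e k\<close>; the
  penalty is at most \<open>e k\<close>, and its power \<open>2 * \<theta> \<ge> 1\<close> does not
  increase it when \<open>e k < 1\<close>.\<close>

lemma merit_error_bound:
  assumes KL: "KL_function F \<theta>" and \<theta>: "1 / 2 \<le> \<theta>"
    and \<omega>: "Fval \<longlonglongrightarrow> \<omega>" and d0: "d \<longlonglongrightarrow> 0" and e0: "e \<longlonglongrightarrow> 0"
  shows "\<exists>B>0. \<forall>\<^sub>F k in sequentially. \<omega> < h (Suc k) \<longrightarrow> (h (Suc k) - \<omega>) powr (2 * \<theta>) \<le> B * e k"
proof -
  obtain K :: nat where K: "\<forall>\<^sub>F k in sequentially. \<omega> < Fval (Suc k) \<longrightarrow>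
      (Fval (Suc k) - \<omega>) powr \<theta> \<le> real K * (d (Suc k) + d k)"
    using KL_along_iterates[OF KL \<omega> d0] by blast
  define B where "B = 2 powr (2 * \<theta>) * (2 * (real K)\<^sup>2 + 1)"
  have "0 < B" unfolding B_def by (intro mult_pos_pos) (auto intro: add_nonneg_pos)
  moreover have "\<forall>\<^sub>F k in sequentially. e k < 1"
    using e0 by (rule order_tendstoD) simp
  with K have "\<forall>\<^sub>F k in sequentially. \<omega> < h (Suc k) \<longrightarrow> (h (Suc k) - \<omega>) powr (2 * \<theta>) \<le> B * e k"
  proof eventually_elim
    case (elim k)
    show ?case
    proof
      assume pos: "\<omega> < h (Suc k)"
      define t where "t = Fval (Suc k) - \<omega>"
      have "\<delta> / 2 * (d (Suc k))\<^sup>2 \<le> 1 * e k"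
        using \<delta> by (intro mult_mono) (auto simp: e_def)
      \<comment> \<open>Passing to twice the maximum separates the two parts before the power is
        taken. A negative \<open>t\<close> is harmless, as the maximum is then
        \<open>e k\<close>.\<close>
      then have "t + \<delta> / 2 * (d (Suc k))\<^sup>2 \<le> max t (e k) + max t (e k)"
        by (intro add_mono) auto
      then have "h (Suc k) - \<omega> \<le> 2 * max t (e k)"
        by (simp add: h_def t_def)
      then have "(h (Suc k) - \<omega>) powr (2 * \<theta>) \<le> (2 * max t (e k)) powr (2 * \<theta>)"
        using pos \<theta> by (intro powr_mono2) auto
      also have "\<dots> = 2 powr (2 * \<theta>) * (max t (e k)) powr (2 * \<theta>)"
        using e_nonneg[of k] by (simp add: powr_mult)
      also have "(max t (e k)) powr (2 * \<theta>) \<le> (2 * (real K)\<^sup>2 + 1) * e k"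
      proof (cases "t \<le> e k")
        case True
        have "(e k) powr (2 * \<theta>) \<le> (e k) powr 1"
          using \<theta> elim e_nonneg[of k] by (intro powr_mono') auto
        also have "\<dots> = e k" using e_nonneg[of k] by simp
        also have "\<dots> \<le> (2 * (real K)\<^sup>2 + 1) * e k"
          using e_nonneg[of k] by (simp add: algebra_simps)
        finally show ?thesis using True by (simp add: max_absorb2)
      next
        case False
        then have t: "0 < t" using e_nonneg[of k] by simp
        have "t powr (2 * \<theta>) = (t powr \<theta>)\<^sup>2"
          using t by (simp add: powr_power mult.commute)
        also have "\<dots> \<le> (real K * (d (Suc k) + d k))\<^sup>2"
          using elim t by (intro power_mono) (auto simp: t_def)
        also have "\<dots> = (real K)\<^sup>2 * (d (Suc k) + d k)\<^sup>2" by (rule power_mult_distrib)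
        also have "\<dots> \<le> (real K)\<^sup>2 * (2 * e k)"
          using sum_squares_bound[of "d (Suc k)" "d k"]
          by (intro mult_left_mono) (auto simp: e_def power2_sum)
        also have "\<dots> \<le> (2 * (real K)\<^sup>2 + 1) * e k"
          using e_nonneg[of k] by (simp add: algebra_simps)
        finally show ?thesis using False by (simp add: max_absorb1)
      qed
      finally show "(h (Suc k) - \<omega>) powr (2 * \<theta>) \<le> B * e k" by (simp add: B_def mult.assoc)
    qed
  qed
  ultimately show ?thesis by blast
qed

theorem convergence_rate:
  assumes KL: "KL_function F \<theta>" and \<theta>: "1 / 2 \<le> \<theta>"
  shows "\<exists>\<omega>. Fval \<longlonglongrightarrow> \<omega> \<and>
    (\<exists>\<rho> \<gamma>. 0 < \<rho> \<and> \<rho> < 1 \<and> 0 < \<gamma> \<and>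
      (\<forall>\<^sub>F k in sequentially. Fval k - \<omega> \<le>
         (if \<theta> = 1 / 2 then \<gamma> * \<rho> powi \<lceil>(real k - 1) / (real m + 1)\<rceil>
          else \<gamma> * real k powr ((1 - \<theta>) / (1 - 2 * \<theta>)))))"
proof -
  obtain \<omega> where \<omega>: "Fval \<longlonglongrightarrow> \<omega>" "e \<longlonglongrightarrow> 0" "d \<longlonglongrightarrow> 0" "\<And>k. \<omega> \<le> M k"
    using convergence by blast
  define \<Phi> where "\<Phi> k = M k - \<omega>" for k
  have nonneg: "0 \<le> \<Phi> k" for k using \<omega>(4) by (simp add: \<Phi>_def)
  have anti: "antimono \<Phi>"
    using M_antimono unfolding \<Phi>_def antimono_def by simp
  have le: "Fval k - \<omega> \<le> \<Phi> k" for k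
    using Fval_le_h[of k] h_le_M[of k] unfolding \<Phi>_def by linarith
  obtain B where B: "0 < B"
    "\<forall>\<^sub>F k in sequentially. \<omega> < h (Suc k) \<longrightarrow> (h (Suc k) - \<omega>) powr (2 * \<theta>) \<le> B * e k"
    using merit_error_bound[OF KL \<theta> \<omega>(1,3,2)] by blast
  define c where "c = \<alpha> / 2 / B"
  have c: "0 < c" using \<alpha> B by (simp add: c_def)
  obtain K where dec: "\<And>k. K \<le> k \<Longrightarrow> \<Phi> (k + Suc m) + c * \<Phi> (k + Suc m) powr (2 * \<theta>) \<le> \<Phi> k"
    using nonmonotone_block_decrease[where a = "\<alpha> / 2" and e = e and h = h and m = m, OF _ e_nonneg descent \<omega>(4) B] \<alpha>
    unfolding \<Phi>_def c_def by fastforce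
  have "\<exists>\<rho> \<gamma>. 0 < \<rho> \<and> \<rho> < 1 \<and> 0 < \<gamma> \<and>
      (\<forall>\<^sub>F k in sequentially. \<Phi> k \<le>
         (if \<theta> = 1 / 2 then \<gamma> * \<rho> powi \<lceil>(real k - 1) / (real m + 1)\<rceil>
          else \<gamma> * real k powr ((1 - \<theta>) / (1 - 2 * \<theta>))))"
  proof (cases "\<theta> = 1 / 2")
    case True
    have "\<Phi> (k + Suc m) + c * \<Phi> (k + Suc m) \<le> \<Phi> k" if "K \<le> k" for k
      using dec[OF that] nonneg True by simp
    then show ?thesis
      using linear_rate_of_block_decrease[OF c nonneg anti, of K m] unfolding if_P[OF True] by blast
  next
    case False
    then have q: "1 < 2 * \<theta>" using \<theta> by simp
    obtain \<gamma> where \<gamma>: "0 < \<gamma>"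
      "\<forall>\<^sub>F k in sequentially. \<Phi> k \<le> \<gamma> * real k powr (- (1 / (2 * \<theta> - 1)))"
      using sublinear_rate_of_block_decrease[OF c q nonneg anti dec] by blast
    have "\<forall>\<^sub>F k in sequentially. \<Phi> k \<le> \<gamma> * real k powr ((1 - \<theta>) / (1 - 2 * \<theta>))"
      using \<gamma>(2) eventually_ge_at_top[of 1]
    proof eventually_elim
      case (elim k)
      \<comment> \<open>The denominator \<open>1 - 2 * \<theta>\<close> is negative and
        \<open>1 - \<theta> \<le> 1\<close>, so the claimed exponent is the larger one; for
        \<open>k \<ge> 1\<close> its power is the weaker bound.\<close>
      have "- (1 / (2 * \<theta> - 1)) \<le> (1 - \<theta>) / (1 - 2 * \<theta>)"
        using q by (simp add: field_simps)
      then have "real k powr (- (1 / (2 * \<theta> - 1))) \<le> real k powr ((1 - \<theta>) / (1 - 2 * \<theta>))"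
        using elim by (intro powr_mono) auto
      then show ?case using elim(1) \<gamma>(1) by (meson mult_left_mono less_imp_le order_trans)
    qed
    \<comment> \<open>This branch leaves the ratio free; \<open>1 / 2\<close> is one admissible
      value.\<close>
    then show ?thesis using False \<gamma>(1)
      by (intro exI[of _ "1 / 2"] exI[of _ \<gamma>]) simp
  qed
  then obtain \<rho> \<gamma> where "0 < \<rho>" "\<rho> < 1" "0 < \<gamma>"
    and rate: "\<forall>\<^sub>F k in sequentially. \<Phi> k \<le>
         (if \<theta> = 1 / 2 then \<gamma> * \<rho> powi \<lceil>(real k - 1) / (real m + 1)\<rceil>
          else \<gamma> * real k powr ((1 - \<theta>) / (1 - 2 * \<theta>)))"
    by blast
  moreover from rate have "\<forall>\<^sub>F k in sequentially. Fval k - \<omega> \<le>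
         (if \<theta> = 1 / 2 then \<gamma> * \<rho> powi \<lceil>(real k - 1) / (real m + 1)\<rceil>
          else \<gamma> * real k powr ((1 - \<theta>) / (1 - 2 * \<theta>)))"
    by (rule eventually_mono) (use le order_trans in blast)
  ultimately show ?thesis using \<omega>(1) by blast
qed

end

theorem corollary4p5:
  fixes f :: "'a::euclidean_space \<Rightarrow> real" and g :: "'a \<Rightarrow> ereal"
    and L \<delta> \<alpha> \<tau>min \<tau>max \<beta>max \<eta>1 \<eta>2 \<theta> :: real and m :: nat and x :: "nat \<Rightarrow> 'a"
  assumes "L_smooth L f"
    and "proper_fun g" and "lsc_fun g" and "bounded_below_fun g"
    and "coercive_fun (composite f g)" and "bounded_below_fun (composite f g)"
    and "0 < \<delta>" and "\<delta> < 1 / 2" and "0 < \<alpha>" and "\<alpha> < \<delta> / 2"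
    and "0 < \<tau>min" and "\<tau>min \<le> 1 / (2 * (\<alpha> + \<delta>) + L)" and "1 / (2 * (\<alpha> + \<delta>) + L) < \<tau>max"
    and "0 \<le> \<beta>max" and "0 < \<eta>1" and "\<eta>1 < 1" and "0 < \<eta>2" and "\<eta>2 < 1"
    and "PGenls_sequence f g m \<delta> \<alpha> \<tau>min \<tau>max \<beta>max \<eta>1 \<eta>2 x"
    and "KL_function (composite f g) \<theta>" and "1 / 2 \<le> \<theta>" and "\<theta> < 1"
  shows "\<exists>\<omega>::real. (\<lambda>k. composite f g (x k)) \<longlonglongrightarrow> ereal \<omega> \<and>
    (\<exists>\<rho> \<gamma>::real. 0 < \<rho> \<and> \<rho> < 1 \<and> 0 < \<gamma> \<and>
      (\<forall>\<^sub>F k in sequentially.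
         composite f g (x k) - ereal \<omega> \<le>
           ereal (if \<theta> = 1 / 2
                  then \<gamma> * \<rho> powi \<lceil>(real k - 1) / (real m + 1)\<rceil>
                  else \<gamma> * real k powr ((1 - \<theta>) / (1 - 2 * \<theta>)))))"
proof -
  interpret PGenls_run f g L \<delta> \<alpha> \<tau>min \<tau>max \<beta>max \<eta>1 \<eta>2 m x
    \<comment> \<open>\<open>KL_function\<close> includes lower semicontinuity, which supplies the
      corresponding locale assumption on the composite.\<close>
    using assms by unfold_locales (auto simp: KL_function_def)
  obtain \<omega> \<rho> \<gamma> where lim: "Fval \<longlonglongrightarrow> \<omega>" and "0 < \<rho>" "\<rho> < 1" "0 < \<gamma>"
    and rate: "\<forall>\<^sub>F k in sequentially. Fval k - \<omega> \<le>
       (if \<theta> = 1 / 2 then \<gamma> * \<rho> powi \<lceil>(real k - 1) / (real m + 1)\<rceil>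
        else \<gamma> * real k powr ((1 - \<theta>) / (1 - 2 * \<theta>)))"
    using convergence_rate[of \<theta>] assms(20,21) by blast
  moreover have "(\<lambda>k. composite f g (x k)) \<longlonglongrightarrow> ereal \<omega>"
    using lim by (simp add: F_eq_Fval tendsto_ereal)
  moreover have "\<forall>\<^sub>F k in sequentially. composite f g (x k) - ereal \<omega> \<le>
       ereal (if \<theta> = 1 / 2 then \<gamma> * \<rho> powi \<lceil>(real k - 1) / (real m + 1)\<rceil>
        else \<gamma> * real k powr ((1 - \<theta>) / (1 - 2 * \<theta>)))"
    using rate by (simp only: F_eq_Fval ereal_minus ereal_less_eq)
  ultimately show ?thesis by blast
qed

end
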